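(* Let $V=V^*\in L^1(0,1)$ and let $m(\lambda)=(\chi'\chi^{-1})(0,\lambda)$ be the matrix-valued Weyl–Titchmarsh function. Then $m$ is analytic in $\mathbb C\setminus\bigcup_{\alpha\ge1}\{\lambda_\alpha\}$ and satisfies the identity $m(\lambda)=m(\overline\lambda)^*$. Moreover, each point $\lambda_\alpha$, $\alpha\ge1$, is a simple pole of $m$ and $$\mathop{\mathrm{res}}_{\lambda=\lambda_\alpha}m(\lambda)\Big|_{\mathcal E_\alpha}=-g_\alpha^{-1},\qquad \mathop{\mathrm{res}}_{\lambda=\lambda_\alpha}m(\lambda)\Big|_{\mathbb C^N\ominus\mathcal E_\alpha}=0,\qquad \alpha\ge1.$$
   Context: Fix an integer $N\ge 1$. Here $V=V^*\in L^1(0,1)$ means that $V$ is an integrable function on $(0,1)$ with values in the Hermitian complex $N\times N$ matrices. Let $H$ be the self-adjoint operator in $L^2(0,1)^N$ given by $H\psi=-\psi''+V(x)\psi$ with boundary conditions $\psi(0)=\psi(1)=0$. Let $\lambda_1<\lambda_2<\dots<\lambda_\alpha<\dots$ be its distinct eigenvalues, and let $k_\alpha\in[1,N]$ be the multiplicity of $\lambda_\alpha$. For $\lambda\in\mathbb C$, $\varphi(x,\lambda)$ and $\chi(x,\lambda)$ are the $N\times N$ matrix-valued solutions of $-y''+Vy=\lambda y$ on $[0,1]$ with $\varphi(0,\lambda)=0$, $\varphi'(0,\lambda)=I$ and $\chi(1,\lambda)=0$, $\chi'(1,\lambda)=I$ respectively, where $'=\partial/\partial x$ and $I$ is the identity matrix.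 Set $S_\alpha=\int_0^1\varphi(t,\lambda_\alpha)^*\varphi(t,\lambda_\alpha)\,dt$, $\mathcal E_\alpha=\mathrm{Ker}\,\varphi(1,\lambda_\alpha)\subset\mathbb C^N$ (one has $\dim\mathcal E_\alpha=k_\alpha$), let $P_\alpha$ be the orthogonal projector of $\mathbb C^N$ onto $\mathcal E_\alpha$, and let $g_\alpha:\mathcal E_\alpha\to\mathcal E_\alpha$ be the positive self-adjoint operator $g_\alpha=(P_\alpha S_\alpha P_\alpha)|_{\mathcal E_\alpha}$. $\mathbb C^N\ominus\mathcal E_\alpha$ denotes the orthogonal complement of $\mathcal E_\alpha$ in $\mathbb C^N$. *)

theory Defs
  imports "HOL-Complex_Analysis.Complex_Analysis"
begin

section \<open>Hermitian linear algebra in \<open>complex ^ 'n\<close>\<close>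

text \<open>The inner product of the type class \<open>real_inner\<close> on \<open>complex ^ 'n\<close> is only the real part
  of the Hermitian one, and \<open>adjoint\<close> refers to it; hence the following definitions.\<close>

definition hinner :: "complex ^ 'n \<Rightarrow> complex ^ 'n \<Rightarrow> complex" where
  "hinner v w = (\<Sum>i\<in>UNIV. v $ i * cnj (w $ i))"

definition ctranspose :: "complex ^ 'n ^ 'm \<Rightarrow> complex ^ 'm ^ 'n" where
  "ctranspose A = map_matrix cnj (transpose A)"

definition orth_compl :: "(complex ^ 'n) set \<Rightarrow> (complex ^ 'n) set" where
  "orth_compl E = {w. \<forall>v\<in>E. hinner w v = 0}"

definition orth_projector :: "(complex ^ 'n) set \<Rightarrow> complex ^ 'n ^ 'n" where
  "orth_projector E = (THE P. P ** P = P \<and> ctranspose P = P \<and> range (\<lambda>v. P *v v) = E)"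

section \<open>The Dirichlet operator\<close>

text \<open>\<open>dy\<close> is the pointwise derivative of \<open>y\<close> on \<open>[0,1]\<close> (one-sided at the end points), and \<open>dy\<close>
  is absolutely continuous on \<open>[0,1]\<close> with almost everywhere derivative \<open>ddy\<close>; absolute
  continuity is expressed by \<open>dy\<close> being an indefinite Lebesgue integral of \<open>ddy\<close>.\<close>

definition ac_derivs ::
    "(real \<Rightarrow> 'a::euclidean_space) \<Rightarrow> (real \<Rightarrow> 'a) \<Rightarrow> (real \<Rightarrow> 'a) \<Rightarrow> bool" where
  "ac_derivs y dy ddy \<longleftrightarrow>
     (\<forall>x\<in>{0..1}. (y has_vector_derivative dy x) (at x within {0..1})) \<and>
     ddy absolutely_integrable_on {0..1} \<and>
     (\<forall>x\<in>{0..1}. dy x = dy 0 + integral {0..x} ddy)"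

definition square_integrable :: "(real \<Rightarrow> complex ^ 'n) \<Rightarrow> bool" where
  "square_integrable f \<longleftrightarrow>
     f \<in> borel_measurable (lebesgue_on {0<..<1}) \<and>
     integrable (lebesgue_on {0<..<1}) (\<lambda>x. (norm (f x))\<^sup>2)"

text \<open>The graph of \<open>H = - d\<^sup>2/dx\<^sup>2 + V\<close> in \<open>L\<^sup>2(0,1)\<^sup>N\<close>: the function \<open>\<psi>\<close> is the continuous
  representative of an element of the domain and \<open>f\<close> represents \<open>H \<psi>\<close>.\<close>

definition dirichlet_op ::
    "(real \<Rightarrow> complex ^ 'n ^ 'n) \<Rightarrow> (real \<Rightarrow> complex ^ 'n) \<Rightarrow> (real \<Rightarrow> complex ^ 'n) \<Rightarrow> bool" where
  "dirichlet_op V \<psi> f \<longleftrightarrow>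
     square_integrable \<psi> \<and> square_integrable f \<and> \<psi> 0 = 0 \<and> \<psi> 1 = 0 \<and>
     (\<exists>d\<psi> dd\<psi>. ac_derivs \<psi> d\<psi> dd\<psi> \<and>
        (AE x in lebesgue_on {0<..<1}. f x = - dd\<psi> x + V x *v \<psi> x))"

text \<open>The set \<open>{\<lambda>\<^sub>\<alpha> | \<alpha> \<ge> 1}\<close> of eigenvalues of \<open>H\<close>.\<close>

definition eigenvalues :: "(real \<Rightarrow> complex ^ 'n ^ 'n) \<Rightarrow> complex set" where
  "eigenvalues V =
     {\<mu>. \<exists>\<psi>. dirichlet_op V \<psi> (\<lambda>x. \<mu> *s \<psi> x) \<and> \<not> (AE x in lebesgue_on {0<..<1}. \<psi> x = 0)}"

section \<open>Matrix solutions and the Weyl--Titchmarsh function\<close>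

definition matrix_solution ::
    "(real \<Rightarrow> complex ^ 'n ^ 'n) \<Rightarrow> complex \<Rightarrow> (real \<Rightarrow> complex ^ 'n ^ 'n) \<Rightarrow>
     (real \<Rightarrow> complex ^ 'n ^ 'n) \<Rightarrow> bool" where
  "matrix_solution V \<mu> y dy \<longleftrightarrow>
     (\<exists>ddy. ac_derivs y dy ddy \<and>
        (AE x in lebesgue_on {0<..<1}. - ddy x + V x ** y x = mat \<mu> ** y x))"

text \<open>The solutions are determined on \<open>[0,1]\<close> only; their values elsewhere are never used.\<close>

definition phi ::
    "(real \<Rightarrow> complex ^ 'n ^ 'n) \<Rightarrow> real \<Rightarrow> complex \<Rightarrow> complex ^ 'n ^ 'n" where
  "phi V x \<mu> = (SOME y. \<exists>dy. matrix_solution V \<mu> y dy \<and> y 0 = 0 \<and> dy 0 = mat 1) x"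

definition chi ::
    "(real \<Rightarrow> complex ^ 'n ^ 'n) \<Rightarrow> real \<Rightarrow> complex \<Rightarrow> complex ^ 'n ^ 'n" where
  "chi V x \<mu> = (SOME y. \<exists>dy. matrix_solution V \<mu> y dy \<and> y 1 = 0 \<and> dy 1 = mat 1) x"

definition weyl_titchmarsh ::
    "(real \<Rightarrow> complex ^ 'n ^ 'n) \<Rightarrow> complex \<Rightarrow> complex ^ 'n ^ 'n" where
  "weyl_titchmarsh V \<mu> =
     vector_derivative (\<lambda>x. chi V x \<mu>) (at 0 within {0..1}) ** matrix_inv (chi V 0 \<mu>)"

definition S_mat :: "(real \<Rightarrow> complex ^ 'n ^ 'n) \<Rightarrow> complex \<Rightarrow> complex ^ 'n ^ 'n" where
  "S_mat V \<mu> = integral {0..1} (\<lambda>t. ctranspose (phi V t \<mu>) ** phi V t \<mu>)"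

definition eigen_ker :: "(real \<Rightarrow> complex ^ 'n ^ 'n) \<Rightarrow> complex \<Rightarrow> (complex ^ 'n) set" where
  "eigen_ker V \<mu> = {v. phi V 1 \<mu> *v v = 0}"

text \<open>Only the restriction of \<open>g_op V \<mu>\<close> to \<open>eigen_ker V \<mu>\<close> is meaningful.\<close>

definition g_op ::
    "(real \<Rightarrow> complex ^ 'n ^ 'n) \<Rightarrow> complex \<Rightarrow> complex ^ 'n \<Rightarrow> complex ^ 'n" where
  "g_op V \<mu> v =
     (let P = orth_projector (eigen_ker V \<mu>) in (P ** S_mat V \<mu> ** P) *v v)"

section \<open>Matrix-valued functions of a complex variable\<close>

definition matrix_analytic_on :: "(complex \<Rightarrow> complex ^ 'n ^ 'm) \<Rightarrow> complex set \<Rightarrow> bool" where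
  "matrix_analytic_on M A \<longleftrightarrow> (\<forall>i j. (\<lambda>z. M z $ i $ j) analytic_on A)"

definition matrix_simple_pole :: "(complex \<Rightarrow> complex ^ 'n ^ 'n) \<Rightarrow> complex \<Rightarrow> bool" where
  "matrix_simple_pole M a \<longleftrightarrow>
     (\<exists>R G. R \<noteq> 0 \<and> matrix_analytic_on G {a} \<and>
        (\<forall>\<^sub>F z in at a. M z = mat (inverse (z - a)) ** R + G z))"

definition matrix_residue :: "(complex \<Rightarrow> complex ^ 'n ^ 'm) \<Rightarrow> complex \<Rightarrow> complex ^ 'n ^ 'm" where
  "matrix_residue M a = (\<chi> i j. residue (\<lambda>z. M z $ i $ j) a)"

end

theory Submission
  imports Defs
begin

text \<open>
  The idea is to write the Weyl--Titchmarsh function as a quotient of entire matrix functions and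
  to invert the denominator near an eigenvalue by an explicit factorization.

  Let \<open>\<theta>\<close> be the solution with the data \<open>\<theta>(0) = I\<close>, \<open>\<theta>'(0) = 0\<close>. Expanding \<open>\<chi>\<close> in the pair
  \<open>\<phi>\<close>, \<open>\<theta>\<close> and evaluating at the right end gives \<open>0 = \<phi>(1) \<chi>'(0) + \<theta>(1) \<chi>(0)\<close>, hence
  \<open>m(\<mu>) = - \<phi>(1,\<mu>)\<inverse> \<theta>(1,\<mu>)\<close> whenever \<open>\<phi>(1,\<mu>)\<close> is invertible, and this holds exactly off the
  spectrum (\<open>not_eigenvalue_iff_det_phi\<close>, \<open>weyl_titchmarsh_formula\<close>).

  Most of what remains is drawn from one computation, the Lagrange identity (\<open>lagrange_identity\<close>): for
  solutions \<open>y\<close> at \<open>\<nu>\<close> and \<open>z\<close> at \<open>\<mu>\<close> the derivative of \<open>y\<^sup>* z' - y'\<^sup>* z\<close> is \<open>(cnj \<nu> - \<mu>) y\<^sup>* z\<close>.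

  \<^item> With \<open>y = \<chi>\<close> at the conjugate point it expresses the difference quotient of \<open>\<mu> \<mapsto> z(1,\<mu>)\<close> as an
    integral depending continuously on \<open>\<mu>\<close>. So \<open>\<phi>(1,\<mu>)\<close> and \<open>\<theta>(1,\<mu>)\<close> are entire, with an explicit
    derivative (\<open>end_value_has_derivative\<close>).
  \<^item> With \<open>y = z = \<phi>\<close> it shows that eigenvalues are real, and with \<open>y\<close>, \<open>z\<close> equal to \<open>\<chi>\<close> at conjugate
    points it gives the symmetry of \<open>m\<close>.
  \<^item> At an eigenvalue \<open>\<lambda>\<close> put \<open>F(\<mu>) = \<phi>(1,\<mu>)\<close>, \<open>T = \<phi>'(1,\<lambda>)\<close> and \<open>E = Ker F(\<lambda>)\<close>. For \<open>u \<in> E\<close> one finds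
    that \<open>T u\<close> is orthogonal to the range of \<open>F(\<lambda>)\<close>, that \<open>\<langle>F'(\<lambda>) x, T u\<rangle> = \<langle>S x, u\<rangle>\<close> and that
    \<open>\<langle>\<theta>(1,\<lambda>) x, T u\<rangle> = \<langle>x, u\<rangle>\<close> (\<open>eigenvalue_boundary_identities\<close>).

  Let \<open>P\<close> be the orthogonal projector onto \<open>E\<close>. Since \<open>F(\<lambda>) P = 0\<close>, one can divide \<open>F(\<mu>) P\<close> by
  \<open>\<mu> - \<lambda>\<close> and obtains \<open>F(\<mu>) = K(\<mu>) (I - P + (\<mu> - \<lambda>) P)\<close> with \<open>K\<close> analytic and
  \<open>K(\<lambda>) = F(\<lambda>) + F'(\<lambda>) P\<close>. The first two identities and the positivity of \<open>S\<close> make \<open>K(\<lambda>)\<close>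
  injective. So \<open>F\<inverse>\<close> has at most a simple pole at \<open>\<lambda>\<close> (\<open>simple_pole_of_inverse\<close>), and the residue of \<open>m\<close> is
  \<open>R = - P K(\<lambda>)\<inverse> \<theta>(1,\<lambda>)\<close>. Pairing \<open>K(\<lambda>) w = \<theta>(1,\<lambda>) x\<close> with \<open>T u\<close> and using the last two
  identities yields \<open>g (P w) = P x\<close>, that is \<open>g (- R x) = P x\<close> for every \<open>x\<close>
  (\<open>weyl_titchmarsh_principal_part\<close>). Because \<open>g\<close> is injective on \<open>E\<close>, this one equation contains
  both residue formulas, the bijectivity of \<open>g\<close> and, as \<open>P\<close> is not zero, also \<open>R \<noteq> 0\<close>.

  As \<open>V\<close> is only integrable, the differential equation is understood through indefinite integrals.
  The first part of the development supplies the calculus of such functions (product rule, Gronwall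
  inequality) and the existence and uniqueness theory for linear equations.
\<close>

(* Frees the symbol $ for the components of a vector. *)
unbundle no fps_syntax

section \<open>Absolutely continuous functions on the unit interval\<close>

text \<open>The function \<open>F\<close> is absolutely continuous on the unit interval with density \<open>f\<close>. The density
  is part of the data because it is determined almost everywhere only, and the calculus below
  produces explicit densities.\<close>
definition primitive :: "(real \<Rightarrow> 'a::euclidean_space) \<Rightarrow> (real \<Rightarrow> 'a) \<Rightarrow> bool" where
  "primitive F f \<longleftrightarrow> f absolutely_integrable_on {0..1} \<and>
     (\<forall>x\<in>{0..1}. F x = F 0 + integral {0..x} f)"

lemma absolutely_integrable_subinterval:
  fixes f :: "real \<Rightarrow> 'a::euclidean_space"
  assumes "f absolutely_integrable_on {0..1}" "0 \<le> s" "t \<le> 1"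
  shows "f absolutely_integrable_on {s..t}" "f integrable_on {s..t}"
proof -
  show "f absolutely_integrable_on {s..t}"
    by (rule absolutely_integrable_on_subinterval[OF assms(1)]) (use assms in auto)
  then show "f integrable_on {s..t}"
    using absolutely_integrable_on_def by blast
qed

lemma primitiveI:
  assumes "f absolutely_integrable_on {0..1}" "\<And>x. x \<in> {0..1} \<Longrightarrow> F x = F 0 + integral {0..x} f"
  shows "primitive F f"
  unfolding primitive_def using assms by blast

lemma primitiveD:
  assumes "primitive F f"
  shows primitive_absolutely_integrable: "f absolutely_integrable_on {0..1}"
    and primitive_eq: "x \<in> {0..1} \<Longrightarrow> F x = F 0 + integral {0..x} f"
  using assms unfolding primitive_def by blast+

lemma primitive_diff:
  assumes F: "primitive F f" and st: "0 \<le> s" "s \<le> t" "t \<le> 1"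
  shows "F t - F s = integral {s..t} f"
proof -
  have "integral {0..s} f + integral {s..t} f = integral {0..t} f"
    by (rule Henstock_Kurzweil_Integration.integral_combine[OF st(1,2)])
       (rule absolutely_integrable_subinterval(2)[OF primitive_absolutely_integrable[OF F] order_refl st(3)])
  moreover have "F t = F 0 + integral {0..t} f" "F s = F 0 + integral {0..s} f"
    using st by (auto intro!: primitive_eq[OF F])
  ultimately show ?thesis by (metis add_diff_cancel_left add_diff_cancel_left')
qed

lemma primitive_integral:
  assumes "f absolutely_integrable_on {0..1}"
  shows "primitive (\<lambda>x. c + integral {0..x} f) f"
  using assms by (simp add: primitive_def)

lemma primitive_continuous:
  assumes F: "primitive F f"
  shows "continuous_on {0..1} F"
proof -
  have "f integrable_on {0..1}"
    using absolutely_integrable_subinterval(2)[OF primitive_absolutely_integrable[OF F]] by simp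
  then have "continuous_on {0..1} (\<lambda>x. F 0 + integral {0..x} f)"
    by (intro continuous_intros indefinite_integral_continuous_1)
  then show ?thesis
    by (rule continuous_on_eq) (metis primitive_eq[OF F])
qed

lemma primitive_linear:
  assumes F: "primitive F f" and h: "bounded_linear h"
  shows "primitive (\<lambda>x. h (F x)) (\<lambda>x. h (f x))"
proof (rule primitiveI)
  note f = primitive_absolutely_integrable[OF F]
  show "(\<lambda>x. h (f x)) absolutely_integrable_on {0..1}"
    using absolutely_integrable_linear[OF f h] by (simp add: o_def)
  fix x :: real assume x: "x \<in> {0..1}"
  then have "h (integral {0..x} f) = integral {0..x} (\<lambda>x. h (f x))"
    using integral_linear[OF absolutely_integrable_subinterval(2)[OF f] h, of 0 x] by (simp add: o_def)
  then show "h (F x) = h (F 0) + integral {0..x} (\<lambda>x. h (f x))"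
    by (metis primitive_eq[OF F x] bounded_linear.linear[OF h] linear_add)
qed

lemma primitive_add:
  assumes F: "primitive F f" and G: "primitive G g"
  shows "primitive (\<lambda>x. F x + G x) (\<lambda>x. f x + g x)"
proof (rule primitiveI)
  note f = primitive_absolutely_integrable[OF F] and g = primitive_absolutely_integrable[OF G]
  show "(\<lambda>x. f x + g x) absolutely_integrable_on {0..1}"
    using f g by (rule set_integral_add)
  fix x :: real assume x: "x \<in> {0..1}"
  then have "integral {0..x} (\<lambda>x. f x + g x) = integral {0..x} f + integral {0..x} g"
    by (intro Henstock_Kurzweil_Integration.integral_add absolutely_integrable_subinterval(2) f g) auto
  then show "F x + G x = F 0 + G 0 + integral {0..x} (\<lambda>x. f x + g x)"
    using primitive_eq[OF F x] primitive_eq[OF G x] by (simp only: ac_simps)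
qed

lemma primitive_cong_negligible:
  assumes F: "primitive F f" and N: "negligible N" "\<And>x. x \<in> {0..1} - N \<Longrightarrow> g x = f x"
  shows "primitive F g"
proof (rule primitiveI)
  show "g absolutely_integrable_on {0..1}"
    using N by (rule absolutely_integrable_spike[OF primitive_absolutely_integrable[OF F]])
  fix x :: real assume x: "x \<in> {0..1}"
  have "integral {0..x} g = integral {0..x} f"
    by (rule integral_spike[OF N(1)]) (use N(2) x in auto)
  then show "F x = F 0 + integral {0..x} g"
    using primitive_eq[OF F x] by simp
qed

lemma primitive_cong:
  assumes F: "primitive F f" and "\<And>x. x \<in> {0..1} \<Longrightarrow> G x = F x" "\<And>x. x \<in> {0..1} \<Longrightarrow> g x = f x"
  shows "primitive G g"
proof -
  have "primitive F g"
    by (rule primitive_cong_negligible[OF F, of "{}"]) (use assms in auto)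
  then show ?thesis
    by (metis primitiveI primitiveD assms(2) atLeastAtMost_iff order_refl zero_le_one)
qed

text \<open>Along a fine partition the increments of \<open>H\<close> add up to at most \<open>C\<close> times the largest
  increment of \<open>M\<close> times the total increment of \<open>M\<close>, which tends to zero. This replaces the almost
  everywhere differentiation of absolutely continuous functions: to verify that \<open>H\<close> has a given density
  it suffices that the error over an interval is of second order in a continuous increasing \<open>M\<close>.\<close>
lemma constant_if_quadratic_bound:
  fixes H :: "real \<Rightarrow> 'a::real_normed_vector" and M :: "real \<Rightarrow> real"
  assumes cont: "continuous_on {0..1} M"
    and mono: "\<And>s t. 0 \<le> s \<Longrightarrow> s \<le> t \<Longrightarrow> t \<le> 1 \<Longrightarrow> M s \<le> M t"
    and bound: "\<And>s t. 0 \<le> s \<Longrightarrow> s \<le> t \<Longrightarrow> t \<le> 1 \<Longrightarrow> norm (H t - H s) \<le> C * (M t - M s)\<^sup>2"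
    and x: "x \<in> {0..1}"
  shows "H x = H 0"
proof -
  have *: "norm (H x - H 0) \<le> e * (M x - M 0)" if "e > 0" for e
  proof -
    define P where "P a b \<longleftrightarrow> (0 \<le> a \<and> a \<le> b \<and> b \<le> x \<longrightarrow> norm (H b - H a) \<le> e * (M b - M a))" for a b
    have "uniformly_continuous_on {0..1} M"
      using cont compact_uniformly_continuous by blast
    moreover have "e / (\<bar>C\<bar> + 1) > 0" using that by simp
    ultimately obtain d where d: "d > 0"
      "\<And>s t. s \<in> {0..1} \<Longrightarrow> t \<in> {0..1} \<Longrightarrow> dist s t < d \<Longrightarrow> dist (M s) (M t) < e / (\<bar>C\<bar> + 1)"
      unfolding uniformly_continuous_on_def by metis
    \<comment> \<open>On intervals shorter than \<open>d\<close> one factor of the square is absorbed into \<open>e\<close>.\<close>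
    have loc: "P a b" if "b - a < d" for a b
      unfolding P_def
    proof (intro impI)
      assume ab: "0 \<le> a \<and> a \<le> b \<and> b \<le> x"
      then have m: "0 \<le> M b - M a" using mono[of a b] x by auto
      have "dist (M b) (M a) < e / (\<bar>C\<bar> + 1)"
        by (rule d(2)) (use ab x that in \<open>auto simp: dist_real_def\<close>)
      then have "(\<bar>C\<bar> + 1) * (M b - M a) \<le> e" using m
        by (simp add: dist_real_def field_simps)
      then have "(\<bar>C\<bar> + 1) * (M b - M a) * (M b - M a) \<le> e * (M b - M a)"
        using m by (intro mult_right_mono)
      moreover have "C * (M b - M a)\<^sup>2 \<le> (\<bar>C\<bar> + 1) * (M b - M a)\<^sup>2"
        by (intro mult_right_mono) auto
      moreover have "norm (H b - H a) \<le> C * (M b - M a)\<^sup>2"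
        using bound[of a b] ab x by auto
      ultimately show "norm (H b - H a) \<le> e * (M b - M a)"
        by (simp add: power2_eq_square mult.assoc)
    qed
    have "P 0 x"
    proof (rule Bolzano)
      fix a b c assume trans: "P a b" "P b c" "a \<le> b" "b \<le> c"
      show "P a c" unfolding P_def
      proof (intro impI)
        assume ac: "0 \<le> a \<and> a \<le> c \<and> c \<le> x"
        have "norm (H c - H a) \<le> norm (H c - H b) + norm (H b - H a)"
          by (metis diff_add_cancel add_diff_eq norm_triangle_ineq)
        also have "\<dots> \<le> e * (M c - M b) + e * (M b - M a)"
          using trans ac by (intro add_mono) (auto simp: P_def)
        finally show "norm (H c - H a) \<le> e * (M c - M a)" by (simp add: algebra_simps)
      qed
    qed (use x loc d(1) in auto)
    then show ?thesis using x by (simp add: P_def)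
  qed
  have "norm (H x - H 0) \<le> 0"
  proof (rule field_le_epsilon)
    fix e :: real assume e: "e > 0"
    have m: "0 \<le> M x - M 0" using mono[of 0 x] x by auto
    have "norm (H x - H 0) \<le> e / (M x - M 0 + 1) * (M x - M 0)"
      using *[of "e / (M x - M 0 + 1)"] e m by simp
    also have "\<dots> \<le> e" using e m by (simp add: field_simps)
    finally show "norm (H x - H 0) \<le> 0 + e" by simp
  qed
  then show ?thesis by simp
qed

lemma continuous_measurable_bounded:
  assumes "continuous_on {0..1::real} (F :: real \<Rightarrow> 'a::euclidean_space)"
  shows "F \<in> borel_measurable (lebesgue_on {0..1})" "bounded (F ` {0..1})"
  using assms by (auto intro!: continuous_imp_measurable_on_sets_lebesgue compact_imp_bounded compact_continuous_image)

lemma absolutely_integrable_bilinear: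
  fixes mul :: "'a::euclidean_space \<Rightarrow> 'b::euclidean_space \<Rightarrow> 'c::euclidean_space"
    and F f :: "real \<Rightarrow> 'a" and G g :: "real \<Rightarrow> 'b"
  assumes "bounded_bilinear mul"
  shows absolutely_integrable_cont_left:
     "continuous_on {0..1} F \<Longrightarrow> g absolutely_integrable_on {0..1} \<Longrightarrow> (\<lambda>t. mul (F t) (g t)) absolutely_integrable_on {0..1}"
   and absolutely_integrable_cont_right:
     "f absolutely_integrable_on {0..1} \<Longrightarrow> continuous_on {0..1} G \<Longrightarrow> (\<lambda>t. mul (f t) (G t)) absolutely_integrable_on {0..1}"
proof -
  show "(\<lambda>t. mul (F t) (g t)) absolutely_integrable_on {0..1}"
    if "continuous_on {0..1} F" "g absolutely_integrable_on {0..1}"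
    using absolutely_integrable_bounded_measurable_product[of mul F "{0..1}" g]
      continuous_measurable_bounded[OF that(1)] assms that(2)
    by (auto simp: bilinear_conv_bounded_bilinear)
  show "(\<lambda>t. mul (f t) (G t)) absolutely_integrable_on {0..1}"
    if "f absolutely_integrable_on {0..1}" "continuous_on {0..1} G"
    using absolutely_integrable_bounded_measurable_product[of "\<lambda>x y. mul y x" G "{0..1}" f]
      continuous_measurable_bounded[OF that(2)] bounded_bilinear.flip[OF assms] that(1)
    by (auto simp: bilinear_conv_bounded_bilinear)
qed

text \<open>The product rule for absolutely continuous functions. Over \<open>[s, t]\<close> the increment of the product and the
  integral of the proposed density differ by
  \<open>\<integral> mul (f x) (G t - G x) - mul (F x - F s) (g x) dx\<close>, which is quadratic in the integral of
  \<open>norm f + norm g\<close> over \<open>[s, t]\<close>.\<close>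
lemma primitive_bilinear:
  fixes mul :: "'a::euclidean_space \<Rightarrow> 'b::euclidean_space \<Rightarrow> 'c::euclidean_space"
  assumes bil: "bounded_bilinear mul" and F: "primitive F f" and G: "primitive G g"
  shows "primitive (\<lambda>x. mul (F x) (G x)) (\<lambda>x. mul (f x) (G x) + mul (F x) (g x))"
proof -
  interpret bounded_bilinear mul by fact
  obtain K where K: "0 < K" "\<And>a b. norm (mul a b) \<le> norm a * norm b * K"
    using pos_bounded by blast
  have f: "f absolutely_integrable_on {0..1}" and g: "g absolutely_integrable_on {0..1}"
    using F G by (auto dest: primitive_absolutely_integrable)
  define h where "h x = mul (f x) (G x) + mul (F x) (g x)" for x
  have h: "h absolutely_integrable_on {0..1}"
    unfolding h_def
    by (intro set_integral_add absolutely_integrable_cont_left[OF bil]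
        absolutely_integrable_cont_right[OF bil] primitive_continuous[OF F] primitive_continuous[OF G] f g)
  define k where "k x = norm (f x) + norm (g x)" for x
  have nf: "(\<lambda>x. norm (f x)) absolutely_integrable_on {0..1}" "(\<lambda>x. norm (g x)) absolutely_integrable_on {0..1}"
    using absolutely_integrable_norm[OF f] absolutely_integrable_norm[OF g] by (auto simp: o_def)
  have k: "k absolutely_integrable_on {0..1}"
    unfolding k_def using nf by (rule set_integral_add)
  define M where "M x = 0 + integral {0..x} k" for x
  have M: "primitive M k" unfolding M_def by (rule primitive_integral[OF k])
  have m_sub: "norm (F b - F a) \<le> M t - M s" "norm (G b - G a) \<le> M t - M s"
    if "0 \<le> s" "s \<le> a" "a \<le> b" "b \<le> t" "t \<le> 1" for s t a b
  proof -
    have "norm (F b - F a) \<le> integral {a..b} k"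
      using that
      by (subst primitive_diff[OF F]; (intro Henstock_Kurzweil_Integration.integral_norm_bound_integral
           absolutely_integrable_subinterval(2) f k)?) (auto simp: k_def)
    moreover have "norm (G b - G a) \<le> integral {a..b} k"
      using that
      by (subst primitive_diff[OF G]; (intro Henstock_Kurzweil_Integration.integral_norm_bound_integral
           absolutely_integrable_subinterval(2) g k)?) (auto simp: k_def)
    moreover have "integral {a..b} k \<le> integral {s..t} k"
      using that by (intro integral_subset_le absolutely_integrable_subinterval(2) k) (auto simp: k_def)
    ultimately show "norm (F b - F a) \<le> M t - M s" "norm (G b - G a) \<le> M t - M s"
      using primitive_diff[OF M, of s t] that by auto
  qed
  define H where "H x = mul (F x) (G x) - integral {0..x} h" for x
  have const: "H x = H 0" if x: "x \<in> {0..1}" for x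
  proof (rule constant_if_quadratic_bound[OF primitive_continuous[OF M] _ _ x, where C = K])
    fix s t :: real assume st: "0 \<le> s" "s \<le> t" "t \<le> 1"
    show "M s \<le> M t" using m_sub(1)[OF st(1) order_refl st(2) order_refl st(3)]
      by (smt (verit) norm_ge_zero)
    note int = absolutely_integrable_subinterval(2)[OF _ st(1) st(3)]
    have int1: "(\<lambda>x. mul (f x) (G t)) integrable_on {s..t}" "(\<lambda>x. mul (F s) (g x)) integrable_on {s..t}"
      using integrable_linear[OF int[OF f] bounded_linear_left] integrable_linear[OF int[OF g] bounded_linear_right]
      by (auto simp: o_def)
    have "integral {0..t} h - integral {0..s} h = integral {s..t} h"
      using primitive_diff[OF primitive_integral[OF h, of 0] st] by simp
    then have "H t - H s = mul (F t - F s) (G t) + mul (F s) (G t - G s) - integral {s..t} h"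
      by (simp add: H_def diff_left diff_right algebra_simps)
    also have "\<dots> = integral {s..t} (\<lambda>x. mul (f x) (G t)) + integral {s..t} (\<lambda>x. mul (F s) (g x)) - integral {s..t} h"
      unfolding primitive_diff[OF F st] primitive_diff[OF G st]
      using integral_linear[OF int[OF f] bounded_linear_left, of "G t"] integral_linear[OF int[OF g] bounded_linear_right, of "F s"]
      by (simp add: o_def)
    also have "\<dots> = integral {s..t} (\<lambda>x. mul (f x) (G t) + mul (F s) (g x) - h x)"
      using int1 int[OF h] by (subst Henstock_Kurzweil_Integration.integral_diff;
           (subst Henstock_Kurzweil_Integration.integral_add)?; (intro integrable_add)?; simp?)
    also have "norm \<dots> \<le> integral {s..t} (\<lambda>x. (K * (M t - M s)) * k x)"
    proof (rule Henstock_Kurzweil_Integration.integral_norm_bound_integral)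
      show "(\<lambda>x. mul (f x) (G t) + mul (F s) (g x) - h x) integrable_on {s..t}"
        by (intro integrable_diff integrable_add int1 int[OF h])
      show "(\<lambda>x. (K * (M t - M s)) * k x) integrable_on {s..t}"
        using integrable_cmul[OF int[OF k], of "K * (M t - M s)"] by simp
      fix x assume x: "x \<in> {s..t}"
      have "mul (f x) (G t) + mul (F s) (g x) - h x = mul (f x) (G t - G x) + - mul (F x - F s) (g x)"
        by (simp add: h_def diff_left diff_right algebra_simps)
      also have "norm \<dots> \<le> norm (mul (f x) (G t - G x)) + norm (mul (F x - F s) (g x))"
        by (metis norm_minus_cancel norm_triangle_ineq)
      also have "\<dots> \<le> norm (f x) * norm (G t - G x) * K + norm (F x - F s) * norm (g x) * K"
        by (intro add_mono K)
      also have "\<dots> \<le> norm (f x) * (M t - M s) * K + (M t - M s) * norm (g x) * K"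
        using x st K(1) by (intro add_mono mult_right_mono mult_left_mono m_sub) auto
      finally show "norm (mul (f x) (G t) + mul (F s) (g x) - h x) \<le> (K * (M t - M s)) * k x"
        by (simp add: k_def algebra_simps)
    qed
    also have "\<dots> = K * (M t - M s) * (M t - M s)"
      unfolding primitive_diff[OF M st] by simp
    finally show "norm (H t - H s) \<le> K * (M t - M s)\<^sup>2" by (simp add: power2_eq_square)
  qed
  then have "mul (F x) (G x) = mul (F 0) (G 0) + integral {0..x} h" if "x \<in> {0..1}" for x
  proof -
    have "mul (F x) (G x) - integral {0..x} h = mul (F 0) (G 0)"
      using const[OF that] unfolding H_def by simp
    then show ?thesis by (simp add: algebra_simps)
  qed
  then have "primitive (\<lambda>x. mul (F x) (G x)) h" by (intro primitiveI h)
  then show ?thesis unfolding h_def .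
qed

text \<open>The source of the factorials in the convergence of iterated integrals against an integrable
  kernel.\<close>
lemma primitive_power_fact:
  fixes W :: "real \<Rightarrow> real"
  assumes W: "primitive W q" and W0: "W 0 = 0"
  shows "primitive (\<lambda>x. W x ^ Suc n / fact (Suc n)) (\<lambda>x. q x * (W x ^ n / fact n))"
proof (induction n)
  case 0
  then show ?case using W by simp
next
  case (Suc n)
  have "bounded_linear (\<lambda>r. r / real (n + 2))"
    by (rule bounded_linear_divide)
  from primitive_linear[OF primitive_bilinear[OF bounded_bilinear_mult Suc W] this]
  show ?case
  proof (rule primitive_cong)
    fix x :: real
    have 1: "fact (Suc (Suc n)) = (2 + real n) * ((1 + real n) * fact n)" "fact (Suc n) = (1 + real n) * fact n"
      by (simp_all add: algebra_simps)
    show "W x ^ Suc (Suc n) / fact (Suc (Suc n)) = W x ^ Suc n / fact (Suc n) * W x / real (n + 2)"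
      unfolding 1 by (simp add: field_simps)
    show "q x * (W x ^ Suc n / fact (Suc n)) =
         (q x * (W x ^ n / fact n) * W x + W x ^ Suc n / fact (Suc n) * q x) / real (n + 2)"
      unfolding 1 by (simp add: divide_simps) (simp add: algebra_simps)
  qed
qed

section \<open>Linear differential equations with integrable coefficients\<close>

lemma primitive_cmult:
  fixes F :: "real \<Rightarrow> real"
  assumes "primitive F f" shows "primitive (\<lambda>x. c * F x) (\<lambda>x. c * f x)"
  using primitive_linear[OF assms bounded_linear_mult_right[of c]] .

lemma primitive_sum_powers:
  fixes W :: "real \<Rightarrow> real"
  assumes W: "primitive W q" and W0: "W 0 = 0"
  shows "primitive (\<lambda>x. \<Sum>k<n. W x ^ Suc k / fact (Suc k)) (\<lambda>x. q x * (\<Sum>k<n. W x ^ k / fact k))"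
proof (induction n)
  case 0
  then show ?case by (simp add: primitive_def)
next
  case (Suc n)
  show ?case
    using primitive_add[OF Suc primitive_power_fact[OF W W0, of n]]
    by (simp add: algebra_simps del: fact_Suc power_Suc)
qed

text \<open>Inserting the hypothesis into itself \<open>n\<close> times bounds \<open>u\<close> by a partial sum of \<open>c * exp W\<close> plus a
  remainder of size \<open>W ^ n / fact n\<close>, where \<open>W\<close> is the indefinite integral of \<open>q\<close>.\<close>
lemma gronwall_L1:
  fixes u :: "real \<Rightarrow> real"
  assumes q: "q absolutely_integrable_on {0..1}" and q0: "\<And>t. t \<in> {0..1} \<Longrightarrow> 0 \<le> q t"
    and u: "continuous_on {0..1} u"
    and le: "\<And>x. x \<in> {0..1} \<Longrightarrow> u x \<le> c + integral {0..x} (\<lambda>t. q t * u t)"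
    and x: "x \<in> {0..1}"
  shows "u x \<le> c * exp (integral {0..x} q)"
proof -
  define W where "W x = 0 + integral {0..x} q" for x
  have W: "primitive W q" unfolding W_def by (rule primitive_integral[OF q])
  have W0: "W 0 = 0" by (simp add: W_def)
  have qu: "(\<lambda>t. q t * v t) absolutely_integrable_on {0..1}" if "continuous_on {0..1} v" for v :: "real \<Rightarrow> real"
    by (rule absolutely_integrable_cont_right[OF bounded_bilinear_mult q that])
  obtain B where B: "\<And>t. t \<in> {0..1} \<Longrightarrow> u t \<le> B"
    using continuous_attains_sup[OF compact_Icc _ u] by fastforce
  have Wc: "continuous_on {0..1} W" by (rule primitive_continuous[OF W])
  have *: "u x \<le> c * (\<Sum>k<n. W x ^ k / fact k) + B * (W x ^ n / fact n)" if "x \<in> {0..1}" for x n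
    using that
  proof (induction n arbitrary: x)
    case 0
    then show ?case using B by simp
  next
    case (Suc n)
    define v where "v t = c * (\<Sum>k<n. W t ^ k / fact k) + B * (W t ^ n / fact n)" for t
    have v: "continuous_on {0..1} v"
      unfolding v_def by (intro continuous_intros Wc) auto
    have "primitive (\<lambda>t. c * (\<Sum>k<n. W t ^ Suc k / fact (Suc k)) + B * (W t ^ Suc n / fact (Suc n)))
         (\<lambda>t. c * (q t * (\<Sum>k<n. W t ^ k / fact k)) + B * (q t * (W t ^ n / fact n)))"
      by (intro primitive_add primitive_cmult primitive_sum_powers primitive_power_fact W W0)
    moreover have "(\<lambda>t. c * (q t * (\<Sum>k<n. W t ^ k / fact k)) + B * (q t * (W t ^ n / fact n))) = (\<lambda>t. q t * v t)"
      by (simp add: v_def fun_eq_iff algebra_simps)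
    ultimately have P: "primitive (\<lambda>t. c * (\<Sum>k<n. W t ^ Suc k / fact (Suc k)) + B * (W t ^ Suc n / fact (Suc n))) (\<lambda>t. q t * v t)"
      by simp
    have "u x \<le> c + integral {0..x} (\<lambda>t. q t * u t)" by (rule le[OF Suc.prems])
    also have "integral {0..x} (\<lambda>t. q t * u t) \<le> integral {0..x} (\<lambda>t. q t * v t)"
    proof (rule Henstock_Kurzweil_Integration.integral_le)
      show "(\<lambda>t. q t * u t) integrable_on {0..x}" "(\<lambda>t. q t * v t) integrable_on {0..x}"
        using Suc.prems by (auto intro!: absolutely_integrable_subinterval(2) qu u v)
      fix t assume "t \<in> {0..x}"
      then have "t \<in> {0..1}" using Suc.prems by auto
      then show "q t * u t \<le> q t * v t"
        using Suc.IH[of t] q0[of t] by (intro mult_left_mono) (auto simp: v_def)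
    qed
    also have "integral {0..x} (\<lambda>t. q t * v t) =
        c * (\<Sum>k<n. W x ^ Suc k / fact (Suc k)) + B * (W x ^ Suc n / fact (Suc n))"
      using primitive_eq[OF P Suc.prems] by (simp add: W0 del: fact_Suc)
    also have "c + (c * (\<Sum>k<n. W x ^ Suc k / fact (Suc k)) + B * (W x ^ Suc n / fact (Suc n)))
       = c * (\<Sum>k<Suc n. W x ^ k / fact k) + B * (W x ^ Suc n / fact (Suc n))"
      unfolding sum.lessThan_Suc_shift by (simp add: algebra_simps del: fact_Suc power_Suc)
    finally show ?case by simp
  qed
  have sums: "(\<lambda>n. W x ^ n / fact n) sums exp (W x)"
    using exp_converges[of "W x"] by (simp add: divide_inverse mult.commute)
  have lim: "(\<lambda>n. c * (\<Sum>k<n. W x ^ k / fact k) + B * (W x ^ n / fact n)) \<longlonglongrightarrow> c * exp (W x) + B * 0"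
    using sums summable_LIMSEQ_zero[OF sums_summable[OF sums]]
    by (intro tendsto_intros) (auto simp: sums_def)
  have "u x \<le> c * exp (W x) + B * 0"
    by (rule LIMSEQ_le_const[OF lim]) (use * x in auto)
  then show ?thesis by (simp add: W_def)
qed

text \<open>Picard iteration: the increments of the iterates are bounded by \<open>W ^ n / fact n\<close> with \<open>W\<close> the
  indefinite integral of \<open>q\<close>, so the iteration converges uniformly on the whole interval, however large
  \<open>q\<close> is. Only a right-hand side that is integrable along continuous functions is required.\<close>
lemma linear_ode_exists:
  fixes L :: "real \<Rightarrow> 'a::euclidean_space \<Rightarrow> 'a"
  assumes lin: "\<And>t. linear (L t)"
    and int: "\<And>Y. continuous_on {0..1} Y \<Longrightarrow> (\<lambda>t. L t (Y t)) absolutely_integrable_on {0..1}"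
    and q: "q absolutely_integrable_on {0..1}" and q0: "\<And>t. t \<in> {0..1} \<Longrightarrow> 0 \<le> q t"
    and bound: "\<And>t y. t \<in> {0..1} \<Longrightarrow> norm (L t y) \<le> q t * norm y"
  shows "\<exists>Y. primitive Y (\<lambda>t. L t (Y t)) \<and> Y 0 = c"
proof -
  define W where "W x = 0 + integral {0..x} q" for x
  have W: "primitive W q" unfolding W_def by (rule primitive_integral[OF q])
  have W0: "W 0 = 0" by (simp add: W_def)
  have W_nonneg: "0 \<le> W x" if "x \<in> {0..1}" for x
    unfolding W_def using that q0
    by (auto intro!: Henstock_Kurzweil_Integration.integral_nonneg absolutely_integrable_subinterval(2)[OF q])
  have W_le: "W x \<le> W 1" if "x \<in> {0..1}" for x
  proof -
    have "W 1 - W x = integral {x..1} q" using that by (intro primitive_diff[OF W]) auto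
    also have "\<dots> \<ge> 0" using that q0
      by (auto intro!: Henstock_Kurzweil_Integration.integral_nonneg absolutely_integrable_subinterval(2)[OF q])
    finally show ?thesis by simp
  qed
  have int_bound: "norm (integral {0..x} (\<lambda>t. L t (y t))) \<le> integral {0..x} (\<lambda>t. q t * b t)"
    if "x \<in> {0..1}" "continuous_on {0..1} y" "continuous_on {0..1} b" "\<And>t. t \<in> {0..1} \<Longrightarrow> norm (y t) \<le> b t"
    for x y and b :: "real \<Rightarrow> real"
  proof (rule Henstock_Kurzweil_Integration.integral_norm_bound_integral)
    show "(\<lambda>t. L t (y t)) integrable_on {0..x}"
      using that by (intro absolutely_integrable_subinterval(2) int) auto
    show "(\<lambda>t. q t * b t) integrable_on {0..x}"
      using that by (intro absolutely_integrable_subinterval(2) absolutely_integrable_cont_right[OF bounded_bilinear_mult q]) auto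
    fix t assume "t \<in> {0..x}"
    then have t: "t \<in> {0..1}" using that by auto
    show "norm (L t (y t)) \<le> q t * b t"
      using bound[OF t, of "y t"] mult_left_mono[OF that(4)[OF t] q0[OF t]] by linarith
  qed
  define T where "T y x = integral {0..x} (\<lambda>t. L t (y t))" for y x
  \<comment> \<open>\<open>yn n\<close> is the increment from the \<open>n\<close>-th Picard iterate to the next one.\<close>
  define yn where "yn n = (T ^^ n) (\<lambda>_. c)" for n
  have yn_Suc: "yn (Suc n) = (\<lambda>x. 0 + integral {0..x} (\<lambda>t. L t (yn n t)))" for n
    by (auto simp: yn_def T_def)
  have cont: "continuous_on {0..1} (yn n)" for n
  proof (induction n)
    case (Suc n)
    show ?case unfolding yn_Suc
      by (rule primitive_continuous[OF primitive_integral[OF int[OF Suc]]])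
  qed (simp add: yn_def)
  have yn_bound: "norm (yn n x) \<le> norm c * (W x ^ n / fact n)" if "x \<in> {0..1}" for n x
    using that
  proof (induction n arbitrary: x)
    case (Suc n)
    have "norm (yn (Suc n) x) \<le> integral {0..x} (\<lambda>t. q t * (norm c * (W t ^ n / fact n)))"
      unfolding yn_Suc add_0_left
      by (intro int_bound Suc cont continuous_intros primitive_continuous[OF W]) auto
    also have "\<dots> = integral {0..x} (\<lambda>t. norm c * (q t * (W t ^ n / fact n)))"
      by (simp add: algebra_simps)
    also have "\<dots> = norm c * (W x ^ Suc n / fact (Suc n))"
      using primitive_eq[OF primitive_cmult[OF primitive_power_fact[OF W W0, of n], of "norm c"] Suc.prems]
      by (simp add: W0 del: fact_Suc)
    finally show ?case .
  qed (simp add: yn_def)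
  define S where "S n x = (\<Sum>i<n. yn i x)" for n x
  define Y where "Y x = (\<Sum>i. yn i x)" for x
  have unif: "uniform_limit {0..1} S Y sequentially"
    unfolding S_def Y_def
  proof (rule Weierstrass_m_test)
    fix n and x :: real assume x: "x \<in> {0..1}"
    have "norm (yn n x) \<le> norm c * (W x ^ n / fact n)" by (rule yn_bound[OF x])
    also have "\<dots> \<le> norm c * (W 1 ^ n / fact n)"
      using x W_nonneg W_le by (intro mult_left_mono divide_right_mono power_mono) auto
    finally show "norm (yn n x) \<le> norm c * (W 1 ^ n / fact n)" .
  next
    have "summable (\<lambda>n. W 1 ^ n / fact n)"
      using sums_summable[OF exp_converges[of "W 1"]] by (simp add: divide_inverse mult.commute)
    then show "summable (\<lambda>n. norm c * (W 1 ^ n / fact n))" by (rule summable_mult)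
  qed
  have S_cont: "continuous_on {0..1} (S n)" for n
    unfolding S_def by (intro continuous_intros cont)
  have Y_cont: "continuous_on {0..1} Y"
    by (rule uniform_limit_theorem[OF _ unif]) (use S_cont in auto)
  have S_Suc: "S (Suc n) x = c + integral {0..x} (\<lambda>t. L t (S n t))" if "x \<in> {0..1}" for n x
  proof -
    have "integral {0..x} (\<lambda>t. L t (S n t)) = integral {0..x} (\<lambda>t. \<Sum>i<n. L t (yn i t))"
      unfolding S_def by (simp add: linear_sum[OF lin])
    also have "\<dots> = (\<Sum>i<n. integral {0..x} (\<lambda>t. L t (yn i t)))"
      using that by (intro Henstock_Kurzweil_Integration.integral_sum absolutely_integrable_subinterval(2) int cont) auto
    also have "\<dots> = (\<Sum>i<n. yn (Suc i) x)" by (simp add: yn_Suc)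
    finally show ?thesis unfolding S_def sum.lessThan_Suc_shift by (simp add: yn_def)
  qed
  have Y_eq: "Y x = c + integral {0..x} (\<lambda>t. L t (Y t))" if x: "x \<in> {0..1}" for x
  proof -
    have "(\<lambda>n. integral {0..x} (\<lambda>t. L t (S n t))) \<longlonglongrightarrow> integral {0..x} (\<lambda>t. L t (Y t))"
    proof (rule tendstoI)
      fix e :: real assume e: "e > 0"
      define d where "d = e / (W 1 + 1)"
      have W1: "0 \<le> W 1" by (rule W_nonneg) simp
      then have d: "d > 0" using e by (simp add: d_def)
      show "\<forall>\<^sub>F n in sequentially. dist (integral {0..x} (\<lambda>t. L t (S n t))) (integral {0..x} (\<lambda>t. L t (Y t))) < e"
        using uniform_limitD[OF unif d]
      proof eventually_elim
        case (elim n)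
        have "integral {0..x} (\<lambda>t. L t (S n t)) - integral {0..x} (\<lambda>t. L t (Y t))
            = integral {0..x} (\<lambda>t. L t (S n t) - L t (Y t))"
          using x by (intro Henstock_Kurzweil_Integration.integral_diff[symmetric] absolutely_integrable_subinterval(2) int S_cont Y_cont) auto
        also have "\<dots> = integral {0..x} (\<lambda>t. L t (S n t - Y t))"
          by (simp add: linear_diff[OF lin])
        also have "norm \<dots> \<le> integral {0..x} (\<lambda>t. q t * d)"
          using elim x by (intro int_bound continuous_intros S_cont Y_cont) (auto simp: dist_norm less_imp_le)
        also have "\<dots> = d * W x" by (simp add: W_def mult.commute)
        also have "\<dots> \<le> d * W 1" using d W_le[OF x] by (intro mult_left_mono) auto
        also have "\<dots> < e" using e W1 by (simp add: d_def field_simps)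
        finally show ?case by (simp add: dist_norm)
      qed
    qed
    then have "(\<lambda>n. S (Suc n) x) \<longlonglongrightarrow> c + integral {0..x} (\<lambda>t. L t (Y t))"
      unfolding S_Suc[OF x] by (intro tendsto_intros)
    moreover have "(\<lambda>n. S (Suc n) x) \<longlonglongrightarrow> Y x"
      using tendsto_uniform_limitI[OF unif x] LIMSEQ_Suc by blast
    ultimately show ?thesis by (rule LIMSEQ_unique[symmetric])
  qed
  have Y0: "Y 0 = c" using Y_eq[of 0] by simp
  have "primitive Y (\<lambda>t. L t (Y t))"
    by (rule primitiveI[OF int[OF Y_cont]]) (metis Y_eq Y0)
  then show ?thesis using Y0 by blast
qed

lemma primitive_diff_fun:
  assumes "primitive F f" "primitive G g"
  shows "primitive (\<lambda>x. F x - G x) (\<lambda>x. f x - g x)"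
  using primitive_add[OF assms(1) primitive_linear[OF assms(2) bounded_linear_minus[OF bounded_linear_ident]]] by simp

lemma ac_derivs_iff_primitive:
  "ac_derivs y dy ddy \<longleftrightarrow> primitive y dy \<and> primitive dy ddy"
proof
  assume A: "ac_derivs y dy ddy"
  then have der: "\<And>x. x \<in> {0..1} \<Longrightarrow> (y has_vector_derivative dy x) (at x within {0..1})"
    and dd: "primitive dy ddy"
    unfolding ac_derivs_def primitive_def by blast+
  have "primitive y dy"
  proof (rule primitiveI)
    show "dy absolutely_integrable_on {0..1}"
      by (rule absolutely_integrable_continuous_real[OF primitive_continuous[OF dd]])
    fix x :: real assume x: "x \<in> {0..1}"
    have "(dy has_integral (y x - y 0)) {0..x}"
      by (rule fundamental_theorem_of_calculus)
         (use x in \<open>auto intro: has_vector_derivative_within_subset[OF der]\<close>)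
    from integral_unique[OF this]
    show "y x = y 0 + integral {0..x} dy" by (simp add: algebra_simps)
  qed
  with dd show "primitive y dy \<and> primitive dy ddy" by blast
next
  assume A: "primitive y dy \<and> primitive dy ddy"
  then have y: "primitive y dy" and dd: "primitive dy ddy" by blast+
  have "(y has_vector_derivative dy x) (at x within {0..1})" if x: "x \<in> {0..1}" for x
  proof (rule has_vector_derivative_transform[OF x])
    show "y t = y 0 + integral {0..t} dy" if "t \<in> {0..1}" for t
      by (rule primitive_eq[OF y that])
    have "((\<lambda>t. integral {0..t} dy) has_vector_derivative dy x) (at x within {0..1})"
      by (rule integral_has_vector_derivative[OF primitive_continuous[OF dd] x])
    then show "((\<lambda>t. y 0 + integral {0..t} dy) has_vector_derivative dy x) (at x within {0..1})"
      by (intro derivative_eq_intros) auto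
  qed
  with dd show "ac_derivs y dy ddy"
    unfolding ac_derivs_def primitive_def by blast
qed

text \<open>Passing from the open to the closed interval adds the two end points to the exceptional set.\<close>
lemma AE_imp_negligible_exception:
  assumes "AE x in lebesgue_on {0<..<1::real}. P x"
  obtains N where "negligible N" "\<And>x. x \<in> {0..1} - N \<Longrightarrow> P x"
proof -
  have "AE x in lebesgue. x \<in> {0<..<1} \<longrightarrow> P x"
    using assms by (subst (asm) AE_restrict_space_iff) auto
  then obtain N where N: "N \<in> null_sets lebesgue" "\<And>x. x \<notin> N \<Longrightarrow> x \<in> {0<..<1} \<longrightarrow> P x"
    by (auto elim!: AE_E3)
  show thesis
  proof (rule that[of "N \<union> {0, 1}"])
    show "negligible (N \<union> {0, 1})"
      using N(1) by (simp add: negligible_iff_null_sets[symmetric])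
    show "P x" if "x \<in> {0..1} - (N \<union> {0, 1})" for x
      using that N(2)[of x] by auto
  qed
qed

lemma primitive_cong_AE:
  assumes "primitive F f" "AE x in lebesgue_on {0<..<1}. g x = f x"
  shows "primitive F g"
  using AE_imp_negligible_exception[OF assms(2)] primitive_cong_negligible[OF assms(1)] by metis

lemma primitive_reflect:
  assumes F: "primitive F f"
  shows "primitive (\<lambda>x. F (1 - x)) (\<lambda>x. - f (1 - x))"
proof -
  have refl: "((\<lambda>t. g (1 - t)) has_integral integral {1 - x..1} g) {0..x}"
    if "g integrable_on {1 - x..1}" for x and g :: "real \<Rightarrow> 'b::euclidean_space"
  proof -
    have "((\<lambda>t. g (- t)) has_integral integral {1-x..1} g) {-1..-(1-x)}"
      using that by (subst Henstock_Kurzweil_Integration.has_integral_reflect_real) auto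
    from has_integral_shift_real_ivl[OF this, of "-1"] show ?thesis
      by (simp add: minus_diff_eq)
  qed
  note f = primitive_absolutely_integrable[OF F]
  show ?thesis
  proof (rule primitiveI)
    have "f integrable_on {1-1..1}" "(\<lambda>t. norm (f t)) integrable_on {1-1..1}"
      using f absolutely_integrable_norm[OF f]
      by (auto simp: absolutely_integrable_on_def o_def)
    from refl[OF this(1)] refl[OF this(2)]
    have "(\<lambda>t. f (1 - t)) absolutely_integrable_on {0..1}"
      by (auto simp: absolutely_integrable_on_def)
    from absolutely_integrable_linear[OF this bounded_linear_minus[OF bounded_linear_ident]]
    show "(\<lambda>t. - f (1 - t)) absolutely_integrable_on {0..1}" by (simp add: o_def)
    fix x :: real assume x: "x \<in> {0..1}"
    have "((\<lambda>t. f (1 - t)) has_integral integral {1 - x..1} f) {0..x}"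
      by (rule refl) (use x in \<open>auto intro!: absolutely_integrable_subinterval(2)[OF f]\<close>)
    from integral_unique[OF has_integral_neg[OF this]]
    have "integral {0..x} (\<lambda>t. - f (1 - t)) = - integral {1 - x..1} f" .
    moreover have "F 1 - F (1 - x) = integral {1 - x..1} f"
      by (rule primitive_diff[OF F]) (use x in auto)
    ultimately show "F (1 - x) = F (1 - 0) + integral {0..x} (\<lambda>t. - f (1 - t))" by (simp add: algebra_simps)
  qed
qed

text \<open>An a priori bound for second order equations with forcing \<open>r\<close>: Gronwall's inequality applied
  to \<open>norm y + norm y'\<close>. With \<open>r = 0\<close> and zero data it gives uniqueness, with small \<open>r\<close> continuous
  dependence on parameters.\<close>
lemma second_order_bound:
  fixes y dy :: "real \<Rightarrow> 'a::euclidean_space"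
  assumes y: "primitive y dy" and dy: "primitive dy ddy"
    and q: "q absolutely_integrable_on {0..1}" and q0: "\<And>t. t \<in> {0..1} \<Longrightarrow> 0 \<le> q t"
    and bound: "\<And>t. t \<in> {0..1} \<Longrightarrow> norm (ddy t) \<le> q t * norm (y t) + r" and r: "0 \<le> r"
    and x: "x \<in> {0..1}"
  shows "norm (y x) + norm (dy x) \<le> (norm (y 0) + norm (dy 0) + r) * exp (integral {0..x} (\<lambda>t. 1 + q t))"
proof (rule gronwall_L1[OF _ _ _ _ x])
  have cont: "continuous_on {0..1} (\<lambda>x. norm (y x) + norm (dy x))"
    by (intro continuous_intros primitive_continuous[OF y] primitive_continuous[OF dy])
  show "continuous_on {0..1} (\<lambda>x. norm (y x) + norm (dy x))" by (rule cont)
  have 1: "(\<lambda>t. 1 + q t) absolutely_integrable_on {0..1}"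
    by (intro set_integral_add absolutely_integrable_continuous_real q) auto
  then show "(\<lambda>t. 1 + q t) absolutely_integrable_on {0..1}" .
  show "\<And>t. t \<in> {0..1} \<Longrightarrow> 0 \<le> 1 + q t" using q0 by (simp add: add_nonneg_nonneg)
  fix x :: real assume x: "x \<in> {0..1}"
  define k where "k t = (1 + q t) * (norm (y t) + norm (dy t))" for t
  have k: "k absolutely_integrable_on {0..1}"
    unfolding k_def by (rule absolutely_integrable_cont_right[OF bounded_bilinear_mult 1 cont])
  have kr: "(\<lambda>t. k t + r) integrable_on {0..x}"
    using x by (intro integrable_add absolutely_integrable_subinterval(2)[OF k]) auto
  note sub = absolutely_integrable_subinterval(2)[OF primitive_absolutely_integrable]
  have nd: "(\<lambda>t. norm (dy t)) integrable_on {0..x}" 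
    using x absolutely_integrable_norm[OF primitive_absolutely_integrable[OF y]]
    by (intro absolutely_integrable_subinterval(2)) (auto simp: o_def)
  have qy: "(\<lambda>t. q t * norm (y t)) integrable_on {0..x}"
    using x by (intro absolutely_integrable_subinterval(2) absolutely_integrable_cont_right[OF bounded_bilinear_mult q]
       continuous_intros primitive_continuous[OF y]) auto
  have "y x = y 0 + integral {0..x} dy" by (rule primitive_eq[OF y x])
  then have "norm (y x) \<le> norm (y 0) + norm (integral {0..x} dy)" by (metis norm_triangle_ineq)
  also have "norm (integral {0..x} dy) \<le> integral {0..x} (\<lambda>t. norm (dy t))"
    using x by (intro Henstock_Kurzweil_Integration.integral_norm_bound_integral sub[OF y] nd) auto
  finally have A: "norm (y x) \<le> norm (y 0) + integral {0..x} (\<lambda>t. norm (dy t))" by simp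
  have "dy x = dy 0 + integral {0..x} ddy" by (rule primitive_eq[OF dy x])
  then have "norm (dy x) \<le> norm (dy 0) + norm (integral {0..x} ddy)" by (metis norm_triangle_ineq)
  also have "norm (integral {0..x} ddy) \<le> integral {0..x} (\<lambda>t. q t * norm (y t) + r)"
    using x bound by (intro Henstock_Kurzweil_Integration.integral_norm_bound_integral sub[OF dy] integrable_add qy) auto
  also have "\<dots> = integral {0..x} (\<lambda>t. q t * norm (y t)) + x * r"
    using x by (subst Henstock_Kurzweil_Integration.integral_add[OF qy]) auto
  also have "x * r \<le> r" using x r by (simp add: mult_left_le_one_le)
  finally have B: "norm (dy x) \<le> norm (dy 0) + (integral {0..x} (\<lambda>t. q t * norm (y t)) + r)" by simp
  have "integral {0..x} (\<lambda>t. norm (dy t)) + integral {0..x} (\<lambda>t. q t * norm (y t)) =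
     integral {0..x} (\<lambda>t. norm (dy t) + q t * norm (y t))"
    by (rule Henstock_Kurzweil_Integration.integral_add[OF nd qy, symmetric])
  also have "\<dots> \<le> integral {0..x} k"
  proof (rule Henstock_Kurzweil_Integration.integral_le)
    show "(\<lambda>t. norm (dy t) + q t * norm (y t)) integrable_on {0..x}" by (intro integrable_add nd qy)
    show "k integrable_on {0..x}" using x by (intro absolutely_integrable_subinterval(2)[OF k]) auto
    fix t assume "t \<in> {0..x}"
    then have "0 \<le> q t" using q0 x by auto
    then show "norm (dy t) + q t * norm (y t) \<le> k t" by (simp add: k_def algebra_simps)
  qed
  finally show "norm (y x) + norm (dy x) \<le> norm (y 0) + norm (dy 0) + r +
      integral {0..x} (\<lambda>t. (1 + q t) * (norm (y t) + norm (dy t)))"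
    using A B unfolding k_def by linarith
qed

context
  fixes mul :: "'b::euclidean_space \<Rightarrow> 'a::euclidean_space \<Rightarrow> 'a" and A :: "real \<Rightarrow> 'b"
  assumes bil: "bounded_bilinear mul" and A: "A absolutely_integrable_on {0..1}"
begin

lemma coefficient_bound:
  obtains K where "0 < K" "(\<lambda>t. K * norm (A t)) absolutely_integrable_on {0..1}"
    "\<And>t y. norm (mul (A t) y) \<le> K * norm (A t) * norm y"
proof -
  obtain K where K: "0 < K" "\<And>a b. norm (mul a b) \<le> norm a * norm b * K"
    using bounded_bilinear.pos_bounded[OF bil] by blast
  have "(\<lambda>t. K * norm (A t)) absolutely_integrable_on {0..1}"
    using absolutely_integrable_norm[OF A] by (intro set_integrable_mult_right) (simp add: o_def)
  then show thesis using K by (intro that[of K]) (auto simp: ac_simps)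
qed

text \<open>The equation is the first-order linear system \<open>(y, z)' = (z, A y)\<close> on the product space.\<close>
lemma second_order_exists:
  "\<exists>y dy. primitive y dy \<and> primitive dy (\<lambda>x. mul (A x) (y x)) \<and> y 0 = a \<and> dy 0 = b"
proof -
  obtain K where K: "0 < K" "(\<lambda>t. K * norm (A t)) absolutely_integrable_on {0..1}"
    "\<And>t y. norm (mul (A t) y) \<le> K * norm (A t) * norm y"
    using coefficient_bound by blast
  define L where "L t = (\<lambda>(y, z). (z :: 'a, mul (A t) y))" for t
  have "\<exists>Y. primitive Y (\<lambda>t. L t (Y t)) \<and> Y 0 = (a, b)"
  proof (rule linear_ode_exists)
    show "linear (L t)" for t
      unfolding L_def
      by (rule linearI) (auto simp: bounded_bilinear.add_right[OF bil] bounded_bilinear.scaleR_right[OF bil])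
    show "(\<lambda>t. 1 + K * norm (A t)) absolutely_integrable_on {0..1}"
      by (intro set_integral_add absolutely_integrable_continuous_real K) auto
    show "0 \<le> 1 + K * norm (A t)" for t using K(1) by simp
    show "norm (L t y) \<le> (1 + K * norm (A t)) * norm y" for t y
    proof -
      obtain u v where y: "y = (u, v)" by fastforce
      have "norm (L t y) \<le> norm v + norm (mul (A t) u)"
        unfolding L_def y by (simp add: norm_Pair_le)
      also have "norm v \<le> norm y" unfolding y by (rule norm_snd_le)
      also have "norm (mul (A t) u) \<le> K * norm (A t) * norm u" by (rule K(3))
      also have "\<dots> \<le> K * norm (A t) * norm y"
        unfolding y using K(1) by (intro mult_left_mono norm_fst_le) auto
      finally show ?thesis by (simp add: algebra_simps)
    qed
    fix Y :: "real \<Rightarrow> 'a \<times> 'a" assume Y: "continuous_on {0..1} Y"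
    have l1: "bounded_linear (\<lambda>z::'a. (z, 0::'a))" and l2: "bounded_linear (\<lambda>z::'a. (0::'a, z))"
      by (auto intro!: bounded_linear_Pair bounded_linear_ident bounded_linear_zero)
    have 1: "(\<lambda>t. snd (Y t)) absolutely_integrable_on {0..1}"
      by (intro absolutely_integrable_continuous_real continuous_intros Y)
    have 2: "(\<lambda>t. mul (A t) (fst (Y t))) absolutely_integrable_on {0..1}"
      by (intro absolutely_integrable_cont_right[OF bil A] continuous_intros Y)
    have "(\<lambda>t. (snd (Y t), 0) + (0, mul (A t) (fst (Y t)))) absolutely_integrable_on {0..1}"
      using absolutely_integrable_linear[OF 1 l1] absolutely_integrable_linear[OF 2 l2]
      by (intro set_integral_add) (simp_all add: o_def)
    then show "(\<lambda>t. L t (Y t)) absolutely_integrable_on {0..1}"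
      by (simp add: L_def case_prod_unfold)
  qed
  then obtain Y where Y: "primitive Y (\<lambda>t. L t (Y t))" "Y 0 = (a, b)" by blast
  have "primitive (\<lambda>t. fst (Y t)) (\<lambda>t. snd (Y t))"
    using primitive_linear[OF Y(1) bounded_linear_fst] by (simp add: L_def case_prod_unfold)
  moreover have "primitive (\<lambda>t. snd (Y t)) (\<lambda>t. mul (A t) (fst (Y t)))"
    using primitive_linear[OF Y(1) bounded_linear_snd] by (simp add: L_def case_prod_unfold)
  ultimately show ?thesis using Y(2) by force
qed

lemma second_order_zero:
  fixes y dy :: "real \<Rightarrow> 'a"
  assumes "primitive y dy" "primitive dy (\<lambda>x. mul (A x) (y x))" "y 0 = 0" "dy 0 = 0" "x \<in> {0..1}"
  shows "y x = 0"
proof -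
  obtain K where K: "0 < K" "(\<lambda>t. K * norm (A t)) absolutely_integrable_on {0..1}"
    "\<And>t y. norm (mul (A t) y) \<le> K * norm (A t) * norm y"
    using coefficient_bound by blast
  have "norm (y x) + norm (dy x) \<le> (norm (y 0) + norm (dy 0) + 0) * exp (integral {0..x} (\<lambda>t. 1 + K * norm (A t)))"
    using K by (intro second_order_bound[OF assms(1,2)] assms(5)) auto
  then have "norm (y x) + norm (dy x) \<le> 0" using assms by simp
  then show "y x = 0" using norm_ge_zero[of "dy x"] by (smt (verit) norm_le_zero_iff)
qed

end

section \<open>Complex matrices and the Hermitian inner product\<close>

lemma bounded_bilinear_matrix_mult:
  "bounded_bilinear ((**) :: complex ^ 'n ^ 'm \<Rightarrow> complex ^ 'k ^ 'n \<Rightarrow> complex ^ 'k ^ 'm)"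
  unfolding bilinear_conv_bounded_bilinear[symmetric] bilinear_def
  by (auto intro!: linearI simp: vec_eq_iff matrix_matrix_mult_def algebra_simps sum.distrib scaleR_sum_right)

lemma bounded_bilinear_matrix_vector_mult:
  "bounded_bilinear ((*v) :: complex ^ 'n ^ 'm \<Rightarrow> complex ^ 'n \<Rightarrow> complex ^ 'm)"
  unfolding bilinear_conv_bounded_bilinear[symmetric] bilinear_def
  by (auto intro!: linearI simp: vec_eq_iff matrix_vector_mult_def algebra_simps sum.distrib scaleR_sum_right)

lemmas matrix_mult_diff_left = bounded_bilinear.diff_left[OF bounded_bilinear_matrix_mult]
  and matrix_mult_diff_right = bounded_bilinear.diff_right[OF bounded_bilinear_matrix_mult]
  and matrix_mult_minus_left = bounded_bilinear.minus_left[OF bounded_bilinear_matrix_mult]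
  and matrix_mult_minus_right = bounded_bilinear.minus_right[OF bounded_bilinear_matrix_mult]
  and matrix_mult_zero_left = bounded_bilinear.zero_left[OF bounded_bilinear_matrix_mult]
  and matrix_mult_zero_right = bounded_bilinear.zero_right[OF bounded_bilinear_matrix_mult]

lemma mat_mult_nth [simp]: "(mat c ** A) $ i $ j = c * A $ i $ j"
  for A :: "complex ^ 'k ^ 'n"
  by (simp add: matrix_matrix_mult_def mat_def if_distrib if_distribR sum.delta cong: if_cong)

lemma mat_vector_mult: "mat c *v v = c *s v" for v :: "complex ^ 'n"
  by (simp add: vec_eq_iff matrix_vector_mult_def mat_def if_distrib if_distribR sum.delta cong: if_cong)

text \<open>Multiplication by a complex scalar is written as multiplication by a scalar matrix, because
  complex matrices carry only real scalar multiplication.\<close>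
lemma mat_commute: "A ** (mat c ** B) = mat c ** (A ** B)"
  for A :: "complex ^ 'n ^ 'm" and B :: "complex ^ 'k ^ 'n"
  by (simp add: vec_eq_iff matrix_matrix_mult_def[of A] sum_distrib_left algebra_simps)

lemma norm_mat_mult: "norm (mat c ** A) = cmod c * norm A"
  for A :: "complex ^ 'k ^ 'n"
proof -
  have "norm ((mat c ** A) $ i) = cmod c * norm (A $ i)" for i
    unfolding norm_vec_def mat_mult_nth norm_mult by (rule L2_set_right_distrib[symmetric]) simp
  then show ?thesis
    unfolding norm_vec_def[of "mat c ** A"] norm_vec_def[of A]
    by (simp add: L2_set_right_distrib)
qed

lemma bounded_linear_mat_mult: "bounded_linear (\<lambda>A :: complex ^ 'k ^ 'n. mat c ** A)"
  by (rule bounded_bilinear.bounded_linear_right[OF bounded_bilinear_matrix_mult])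

lemma ctranspose_nth [simp]: "ctranspose A $ i $ j = cnj (A $ j $ i)"
  by (simp add: ctranspose_def map_matrix_def transpose_def)

lemma bounded_linear_ctranspose: "bounded_linear (ctranspose :: complex ^ 'n ^ 'm \<Rightarrow> _)"
  unfolding linear_conv_bounded_linear[symmetric]
  by (auto intro!: linearI simp: vec_eq_iff)

lemma ctranspose_ctranspose [simp]: "ctranspose (ctranspose A) = A"
  by (simp add: vec_eq_iff)

lemma ctranspose_mult: "ctranspose (A ** B) = ctranspose B ** ctranspose A"
  by (simp add: vec_eq_iff matrix_matrix_mult_def mult.commute)

lemma ctranspose_simps [simp]:
  "ctranspose 0 = 0" "ctranspose (- A) = - ctranspose A" "ctranspose (A - B) = ctranspose A - ctranspose B"
  "ctranspose (A + B) = ctranspose A + ctranspose B"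
  by (simp_all add: vec_eq_iff)

lemma ctranspose_mat [simp]: "ctranspose (mat c) = mat (cnj c)"
  by (simp add: vec_eq_iff mat_def)

lemma hinner_matrix: "hinner (A *v v) w = hinner v (ctranspose A *v w)"
proof -
  have "hinner (A *v v) w = (\<Sum>i\<in>UNIV. \<Sum>j\<in>UNIV. A $ i $ j * v $ j * cnj (w $ i))"
    by (simp add: hinner_def matrix_vector_mult_def sum_distrib_right)
  also have "\<dots> = (\<Sum>j\<in>UNIV. \<Sum>i\<in>UNIV. A $ i $ j * v $ j * cnj (w $ i))" by (rule sum.swap)
  also have "\<dots> = hinner v (ctranspose A *v w)"
    by (simp add: hinner_def matrix_vector_mult_def sum_distrib_left algebra_simps)
  finally show ?thesis .
qed

lemma hinner_matrix': "hinner v (A *v w) = hinner (ctranspose A *v v) w"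
  by (simp add: hinner_matrix)

lemma hinner_linear [simp]:
  "hinner (u + v) w = hinner u w + hinner v w" "hinner (c *s v) w = c * hinner v w"
  "hinner (u - v) w = hinner u w - hinner v w" "hinner 0 w = 0" "hinner v 0 = 0"
  "hinner (- v) w = - hinner v w"
  "hinner w (u + v) = hinner w u + hinner w v" "hinner w (c *s v) = cnj c * hinner w v"
  "hinner w (u - v) = hinner w u - hinner w v"
  by (simp_all add: hinner_def sum.distrib sum_subtractf sum_negf sum_distrib_left algebra_simps)

lemma hinner_commute: "hinner v w = cnj (hinner w v)"
  by (simp add: hinner_def mult.commute)

lemma hinner_self: "hinner v v = of_real ((norm v)\<^sup>2)"
proof -
  have "(norm v)\<^sup>2 = (\<Sum>i\<in>UNIV. (cmod (v $ i))\<^sup>2)"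
    by (simp add: norm_vec_def L2_set_def sum_nonneg)
  then show ?thesis by (simp add: hinner_def complex_norm_square del: of_real_power)
qed

lemma hinner_eq_zero [simp]: "hinner v v = 0 \<longleftrightarrow> v = 0"
  by (simp add: hinner_self)

lemma bounded_linear_hinner_left: "bounded_linear (\<lambda>v. hinner v w)"
  unfolding linear_conv_bounded_linear[symmetric]
  by (auto intro!: linearI simp: hinner_def sum.distrib scaleR_sum_right algebra_simps)

lemma hinner_eqI: "(\<And>w. hinner u w = hinner v w) \<Longrightarrow> u = v"
  by (metis hinner_eq_zero hinner_linear(3) right_minus_eq)

lemma mat_diff: "mat a - mat b = (mat (a - b) :: complex ^ 'n ^ 'n)"
  by (simp add: vec_eq_iff mat_def)

section \<open>Solutions of the Schroedinger equation\<close>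

lemma absolutely_integrable_open_closed:
  assumes "f absolutely_integrable_on {0<..<1::real}"
  shows "(f :: real \<Rightarrow> 'a::euclidean_space) absolutely_integrable_on {0..1}"
proof (subst absolutely_integrable_spike_set_eq)
  show "f absolutely_integrable_on {0<..<1}" by fact
  show "negligible {x \<in> {0..1} - {0<..<1::real}. f x \<noteq> 0}"
    by (rule negligible_subset[of "{0, 1}"]) auto
  have "{x \<in> {0<..<1} - {0..1::real}. f x \<noteq> 0} = {}" by auto
  then show "negligible {x \<in> {0<..<1} - {0..1::real}. f x \<noteq> 0}" by (metis negligible_empty)
qed

text \<open>Changing the second derivative on a null set, it may be taken to be \<open>(V - \<mu>) y\<close> at every point.
  This turns the almost everywhere equation into one about indefinite integrals.\<close>
lemma matrix_solution_iff:
  "matrix_solution V \<mu> y dy \<longleftrightarrow>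
     primitive y dy \<and> primitive dy (\<lambda>x. (V x - mat \<mu>) ** y x)"
proof
  assume "matrix_solution V \<mu> y dy"
  then obtain ddy where ddy: "primitive y dy" "primitive dy ddy"
    "AE x in lebesgue_on {0<..<1}. - ddy x + V x ** y x = mat \<mu> ** y x"
    unfolding matrix_solution_def ac_derivs_iff_primitive by blast
  have "AE x in lebesgue_on {0<..<1}. (V x - mat \<mu>) ** y x = ddy x"
    using ddy(3) by eventually_elim (simp add: matrix_mult_diff_left algebra_simps)
  then show "primitive y dy \<and> primitive dy (\<lambda>x. (V x - mat \<mu>) ** y x)"
    by (intro conjI ddy(1) primitive_cong_AE[OF ddy(2)])
next
  assume "primitive y dy \<and> primitive dy (\<lambda>x. (V x - mat \<mu>) ** y x)"
  then show "matrix_solution V \<mu> y dy"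
    unfolding matrix_solution_def ac_derivs_iff_primitive
    by (intro exI[of _ "\<lambda>x. (V x - mat \<mu>) ** y x"]) (simp add: matrix_mult_diff_left)
qed

definition vector_solution ::
    "(real \<Rightarrow> complex ^ 'n ^ 'n) \<Rightarrow> complex \<Rightarrow> (real \<Rightarrow> complex ^ 'n) \<Rightarrow> (real \<Rightarrow> complex ^ 'n) \<Rightarrow> bool" where
  "vector_solution V \<mu> y dy \<longleftrightarrow>
     primitive y dy \<and> primitive dy (\<lambda>x. (V x - mat \<mu>) *v y x)"

lemma dirichlet_op_iff:
  "dirichlet_op V \<psi> (\<lambda>x. \<mu> *s \<psi> x) \<longleftrightarrow> \<psi> 0 = 0 \<and> \<psi> 1 = 0 \<and> (\<exists>d\<psi>. vector_solution V \<mu> \<psi> d\<psi>)"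
proof
  assume D: "dirichlet_op V \<psi> (\<lambda>x. \<mu> *s \<psi> x)"
  then obtain d dd where d: "primitive \<psi> d" "primitive d dd"
    "AE x in lebesgue_on {0<..<1}. \<mu> *s \<psi> x = - dd x + V x *v \<psi> x"
    unfolding dirichlet_op_def ac_derivs_iff_primitive by blast
  have "AE x in lebesgue_on {0<..<1}. (V x - mat \<mu>) *v \<psi> x = dd x"
    using d(3) by eventually_elim (simp add: matrix_vector_mult_diff_rdistrib mat_vector_mult algebra_simps)
  then have "vector_solution V \<mu> \<psi> d"
    unfolding vector_solution_def by (intro conjI d(1) primitive_cong_AE[OF d(2)])
  then show "\<psi> 0 = 0 \<and> \<psi> 1 = 0 \<and> (\<exists>d\<psi>. vector_solution V \<mu> \<psi> d\<psi>)"
    using D unfolding dirichlet_op_def by blast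
next
  assume A: "\<psi> 0 = 0 \<and> \<psi> 1 = 0 \<and> (\<exists>d\<psi>. vector_solution V \<mu> \<psi> d\<psi>)"
  then obtain d where d: "primitive \<psi> d" "primitive d (\<lambda>x. (V x - mat \<mu>) *v \<psi> x)"
    unfolding vector_solution_def by blast
  have sq: "square_integrable f" if f: "continuous_on {0..1} f" for f :: "real \<Rightarrow> complex ^ 'n"
    unfolding square_integrable_def
  proof
    have f': "continuous_on {0<..<1} f" by (rule continuous_on_subset[OF f]) auto
    then show "f \<in> borel_measurable (lebesgue_on {0<..<1})"
      by (rule continuous_imp_measurable_on_sets_lebesgue) auto
    have "(\<lambda>x. (norm (f x))\<^sup>2) absolutely_integrable_on {0..1}"
      by (intro absolutely_integrable_continuous_real continuous_intros f)
    then have "(\<lambda>x. (norm (f x))\<^sup>2) absolutely_integrable_on {0<..<1}"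
      by (rule set_integrable_subset) auto
    then show "integrable (lebesgue_on {0<..<1}) (\<lambda>x. (norm (f x))\<^sup>2)"
      unfolding set_integrable_def by (subst integrable_restrict_space) auto
  qed
  have c: "continuous_on {0..1} \<psi>" by (rule primitive_continuous[OF d(1)])
  have "bounded_linear (\<lambda>v :: complex ^ 'n. \<mu> *s v)"
    using bounded_bilinear.bounded_linear_right[OF bounded_bilinear_matrix_vector_mult, of "mat \<mu>"]
    by (simp add: mat_vector_mult)
  then have c': "continuous_on {0..1} (\<lambda>x. \<mu> *s \<psi> x)"
    by (rule bounded_linear.continuous_on[OF _ c])
  show "dirichlet_op V \<psi> (\<lambda>x. \<mu> *s \<psi> x)"
    unfolding dirichlet_op_def ac_derivs_iff_primitive
  proof (intro conjI exI)
    show "square_integrable \<psi>" "square_integrable (\<lambda>x. \<mu> *s \<psi> x)" by (rule sq[OF c] sq[OF c'])+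
    show "\<psi> 0 = 0" "\<psi> 1 = 0" using A by blast+
    show "primitive \<psi> d" "primitive d (\<lambda>x. (V x - mat \<mu>) *v \<psi> x)" by (fact d)+
    show "AE x in lebesgue_on {0<..<1}. \<mu> *s \<psi> x = - ((V x - mat \<mu>) *v \<psi> x) + V x *v \<psi> x"
      by (simp add: matrix_vector_mult_diff_rdistrib mat_vector_mult)
  qed
qed

text \<open>An eigenfunction is continuous, so vanishing almost everywhere and vanishing everywhere on the
  unit interval are the same.\<close>
lemma eigenvalues_iff:
  "\<mu> \<in> eigenvalues V \<longleftrightarrow>
     (\<exists>\<psi> d\<psi>. vector_solution V \<mu> \<psi> d\<psi> \<and> \<psi> 0 = 0 \<and> \<psi> 1 = 0 \<and> (\<exists>x\<in>{0..1}. \<psi> x \<noteq> 0))"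
proof -
  have AE_iff: "(AE x in lebesgue_on {0<..<1}. \<psi> x = 0) \<longleftrightarrow> (\<forall>x\<in>{0..1}. \<psi> x = 0)"
    if sol: "vector_solution V \<mu> \<psi> d" and 0: "\<psi> 0 = 0" "\<psi> 1 = 0" for \<psi> d
  proof
    assume "AE x in lebesgue_on {0<..<1}. \<psi> x = 0"
    then have AE: "AE x\<in>{0<..<1} in lebesgue. \<psi> x = 0"
      by (subst (asm) AE_restrict_space_iff) auto
    have "continuous_on {0..1} \<psi>"
      using sol primitive_continuous unfolding vector_solution_def by blast
    then have cl: "closed {x \<in> {0..1}. \<psi> x = 0}"
      by (intro continuous_closed_preimage_constant) auto
    have "x \<in> {x \<in> {0..1}. \<psi> x = 0}" if "x \<in> {0<..<1}" for x
      by (rule mem_closed_if_AE_lebesgue_open[of "{0<..<1}"])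
         (use cl AE that in \<open>auto elim: eventually_mono\<close>)
    then show "\<forall>x\<in>{0..1}. \<psi> x = 0"
      using 0 by (metis (mono_tags, lifting) atLeastAtMost_iff greaterThanLessThan_iff mem_Collect_eq order_le_less)
  next
    assume *: "\<forall>x\<in>{0..1}. \<psi> x = 0"
    show "AE x in lebesgue_on {0<..<1}. \<psi> x = 0"
      by (rule AE_I2) (use * in auto)
  qed
  show ?thesis
  proof
    assume "\<mu> \<in> eigenvalues V"
    then obtain \<psi> d where "vector_solution V \<mu> \<psi> d" "\<psi> 0 = 0" "\<psi> 1 = 0"
      "\<not> (AE x in lebesgue_on {0<..<1}. \<psi> x = 0)"
      unfolding eigenvalues_def mem_Collect_eq dirichlet_op_iff by blast
    then show "\<exists>\<psi> d\<psi>. vector_solution V \<mu> \<psi> d\<psi> \<and> \<psi> 0 = 0 \<and> \<psi> 1 = 0 \<and> (\<exists>x\<in>{0..1}. \<psi> x \<noteq> 0)"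
      using AE_iff[of \<psi> d] by blast
  next
    assume "\<exists>\<psi> d\<psi>. vector_solution V \<mu> \<psi> d\<psi> \<and> \<psi> 0 = 0 \<and> \<psi> 1 = 0 \<and> (\<exists>x\<in>{0..1}. \<psi> x \<noteq> 0)"
    then obtain \<psi> d where \<psi>: "vector_solution V \<mu> \<psi> d" "\<psi> 0 = 0" "\<psi> 1 = 0" "\<exists>x\<in>{0..1}. \<psi> x \<noteq> 0"
      by blast
    then have "dirichlet_op V \<psi> (\<lambda>x. \<mu> *s \<psi> x)" unfolding dirichlet_op_iff by blast
    moreover have "\<not> (AE x in lebesgue_on {0<..<1}. \<psi> x = 0)"
      using AE_iff[OF \<psi>(1-3)] \<psi>(4) by blast
    ultimately show "\<mu> \<in> eigenvalues V" unfolding eigenvalues_def by blast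
  qed
qed

lemma absolutely_integrable_reflect_unit:
  fixes A :: "real \<Rightarrow> 'b::euclidean_space"
  assumes "A absolutely_integrable_on {0..1}"
  shows "(\<lambda>x. A (1 - x)) absolutely_integrable_on {0..1}"
  using absolutely_integrable_linear[OF primitive_absolutely_integrable[OF primitive_reflect[OF primitive_integral[OF assms, of 0]]]
       bounded_linear_minus[OF bounded_linear_ident]]
  by (simp add: o_def)

text \<open>The reflection \<open>x \<mapsto> 1 - x\<close> transports the initial value problem at \<open>0\<close> to the one at \<open>1\<close>.\<close>
lemma second_order_reflect:
  fixes mul :: "'b \<Rightarrow> 'a::euclidean_space \<Rightarrow> 'a" and y :: "real \<Rightarrow> 'a"
  assumes "primitive y dy" "primitive dy (\<lambda>x. mul (A x) (y x))"
  shows "primitive (\<lambda>x. y (1 - x)) (\<lambda>x. - dy (1 - x))"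
    "primitive (\<lambda>x. - dy (1 - x)) (\<lambda>x. mul (A (1 - x)) (y (1 - x)))"
  using primitive_reflect[OF assms(1)]
    primitive_linear[OF primitive_reflect[OF assms(2)] bounded_linear_minus[OF bounded_linear_ident]] by simp_all

lemma second_order_exists_right:
  fixes mul :: "'b::euclidean_space \<Rightarrow> 'a::euclidean_space \<Rightarrow> 'a"
  assumes "bounded_bilinear mul" "A absolutely_integrable_on {0..1}"
  shows "\<exists>y dy. primitive y dy \<and> primitive dy (\<lambda>x. mul (A x) (y x)) \<and> y 1 = a \<and> dy 1 = b"
proof -
  obtain z dz where z: "primitive z dz" "primitive dz (\<lambda>x. mul (A (1 - x)) (z x))" "z 0 = a" "dz 0 = - b"
    using second_order_exists[OF assms(1) absolutely_integrable_reflect_unit[OF assms(2)]] by blast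
  show ?thesis
    using second_order_reflect[OF z(1), of mul "\<lambda>x. A (1 - x)"] z
    by (intro exI[of _ "\<lambda>x. z (1 - x)"] exI[of _ "\<lambda>x. - dz (1 - x)"]) auto
qed

lemma second_order_zero_right:
  fixes mul :: "'b::euclidean_space \<Rightarrow> 'a::euclidean_space \<Rightarrow> 'a"
  assumes "bounded_bilinear mul" "A absolutely_integrable_on {0..1}"
    "primitive y dy" "primitive dy (\<lambda>x. mul (A x) (y x))" "y 1 = 0" "dy 1 = 0" "x \<in> {0..1}"
  shows "y x = 0"
proof -
  have "y (1 - (1 - x)) = 0"
    by (rule second_order_zero[OF assms(1) absolutely_integrable_reflect_unit[OF assms(2)]
          second_order_reflect[OF assms(3), of mul A, OF assms(4)]]) (use assms in auto)
  then show ?thesis by simp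
qed

lemma matrix_solution_mult_vector:
  assumes "matrix_solution V \<mu> y dy"
  shows "vector_solution V \<mu> (\<lambda>x. y x *v v) (\<lambda>x. dy x *v v)"
  using assms unfolding matrix_solution_iff vector_solution_def
  using primitive_linear[OF _ bounded_bilinear.bounded_linear_left[OF bounded_bilinear_matrix_vector_mult, of v]]
  by (fastforce simp: matrix_vector_mul_assoc)

lemma matrix_solution_mult_right:
  assumes "matrix_solution V \<mu> y dy"
  shows "matrix_solution V \<mu> (\<lambda>x. y x ** C) (\<lambda>x. dy x ** C)"
  using assms unfolding matrix_solution_iff
  using primitive_linear[OF _ bounded_bilinear.bounded_linear_left[OF bounded_bilinear_matrix_mult, of C]]
  by (fastforce simp: matrix_mul_assoc)

lemma matrix_solution_add:
  assumes "matrix_solution V \<mu> y dy" "matrix_solution V \<mu> z dz"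
  shows "matrix_solution V \<mu> (\<lambda>x. y x + z x) (\<lambda>x. dy x + dz x)"
  using assms unfolding matrix_solution_iff
  by (auto dest: primitive_add simp: matrix_add_ldistrib)

lemma matrix_solution_diff:
  assumes "matrix_solution V \<mu> y dy" "matrix_solution V \<mu> z dz"
  shows "matrix_solution V \<mu> (\<lambda>x. y x - z x) (\<lambda>x. dy x - dz x)"
  using assms unfolding matrix_solution_iff
  by (auto dest: primitive_diff_fun simp: matrix_mult_diff_right)

lemma vector_solution_diff:
  assumes "vector_solution V \<mu> y dy" "vector_solution V \<mu> z dz"
  shows "vector_solution V \<mu> (\<lambda>x. y x - z x) (\<lambda>x. dy x - dz x)"
  using assms unfolding vector_solution_def
  by (auto dest: primitive_diff_fun simp: matrix_vector_mult_diff_distrib)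

lemma matrix_solution_continuous:
  assumes "matrix_solution V \<mu> y dy"
  shows "continuous_on {0..1} y" "continuous_on {0..1} dy"
  using assms primitive_continuous unfolding matrix_solution_iff by blast+

lemma matrix_solution_derivative:
  assumes "matrix_solution V \<mu> y dy" "x \<in> {0..1}"
  shows "(y has_vector_derivative dy x) (at x within {0..1})"
  using assms unfolding matrix_solution_def ac_derivs_def by blast

lemma vector_solution_derivative:
  assumes "vector_solution V \<mu> y dy" "x \<in> {0..1}"
  shows "(y has_vector_derivative dy x) (at x within {0..1})"
proof -
  have "ac_derivs y dy (\<lambda>x. (V x - mat \<mu>) *v y x)"
    using assms unfolding ac_derivs_iff_primitive vector_solution_def by blast
  then show ?thesis using assms(2) unfolding ac_derivs_def by blast
qed

text \<open>Used to read off an initial vector of a solution that vanishes identically; the end points are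
  covered because the derivative is one-sided there.\<close>
lemma vector_solution_vanishing_derivative:
  fixes y dy :: "real \<Rightarrow> complex ^ 'n"
  assumes "vector_solution V \<mu> y dy" "\<And>x. x \<in> {0..1} \<Longrightarrow> y x = 0" "x \<in> {0..1}"
  shows "dy x = 0"
proof -
  have "((\<lambda>_. 0) has_vector_derivative dy x) (at x within {0..1})"
    by (rule has_vector_derivative_transform[OF assms(3) _ vector_solution_derivative[OF assms(1,3)]])
       (simp add: assms(2))
  from vector_derivative_within_closed_interval[OF zero_less_one assms(3) this]
    vector_derivative_within_closed_interval[OF zero_less_one assms(3) has_vector_derivative_const[of "0 :: complex ^ 'n"]]
  show ?thesis by simp
qed

lemma resolvent_coefficient_integrable:
  fixes V :: "real \<Rightarrow> complex ^ 'n ^ 'n"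
  assumes "V absolutely_integrable_on {0..1}"
  shows "(\<lambda>x. V x - mat \<mu>) absolutely_integrable_on {0..1}"
  by (intro set_integral_diff(1)[OF assms] absolutely_integrable_continuous_real continuous_on_const)

context
  fixes V :: "real \<Rightarrow> complex ^ 'n ^ 'n"
  assumes V: "V absolutely_integrable_on {0..1}"
begin

lemma matrix_solution_exists_left: "\<exists>y dy. matrix_solution V \<mu> y dy \<and> y 0 = a \<and> dy 0 = b"
  using second_order_exists[OF bounded_bilinear_matrix_mult resolvent_coefficient_integrable[OF V]] unfolding matrix_solution_iff by blast

lemma matrix_solution_exists_right: "\<exists>y dy. matrix_solution V \<mu> y dy \<and> y 1 = a \<and> dy 1 = b"
  using second_order_exists_right[OF bounded_bilinear_matrix_mult resolvent_coefficient_integrable[OF V]] unfolding matrix_solution_iff by blast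

lemma matrix_solution_unique:
  assumes "matrix_solution V \<mu> y dy" "matrix_solution V \<mu> z dz" "y 0 = z 0" "dy 0 = dz 0" "x \<in> {0..1}"
  shows "y x = z x"
  using second_order_zero[OF bounded_bilinear_matrix_mult resolvent_coefficient_integrable[OF V], of "\<lambda>x. y x - z x" "\<lambda>x. dy x - dz x" \<mu> x]
    matrix_solution_diff[OF assms(1,2)] assms(3-5) unfolding matrix_solution_iff by auto

lemma vector_solution_unique:
  assumes "vector_solution V \<mu> y dy" "vector_solution V \<mu> z dz" "y 0 = z 0" "dy 0 = dz 0" "x \<in> {0..1}"
  shows "y x = z x"
  using second_order_zero[OF bounded_bilinear_matrix_vector_mult resolvent_coefficient_integrable[OF V], of "\<lambda>x. y x - z x" "\<lambda>x. dy x - dz x" \<mu> x]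
    vector_solution_diff[OF assms(1,2)] assms(3-5) unfolding vector_solution_def by auto

lemma vector_solution_unique_right:
  assumes "vector_solution V \<mu> y dy" "vector_solution V \<mu> z dz" "y 1 = z 1" "dy 1 = dz 1" "x \<in> {0..1}"
  shows "y x = z x"
  using second_order_zero_right[OF bounded_bilinear_matrix_vector_mult resolvent_coefficient_integrable[OF V], of "\<lambda>x. y x - z x" "\<lambda>x. dy x - dz x" \<mu> x]
    vector_solution_diff[OF assms(1,2)] assms(3-5) unfolding vector_solution_def by auto

text \<open>The difference \<open>D\<close> of the solutions at \<open>\<mu>\<close> and \<open>\<mu>0\<close> has zero data and satisfies
  \<open>D'' = (V - \<mu>0) D - (\<mu> - \<mu>0) D - (\<mu> - \<mu>0) Y\<^sub>0\<close> with \<open>Y\<^sub>0\<close> the solution at \<open>\<mu>0\<close>. The last term is a forcing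
  of size \<open>cmod (\<mu> - \<mu>0)\<close>.\<close>
lemma solution_family_lipschitz:
  assumes sol: "\<And>\<mu>. matrix_solution V \<mu> (Y \<mu>) (dY \<mu>)" and init: "\<And>\<mu>. Y \<mu> 0 = a" "\<And>\<mu>. dY \<mu> 0 = b"
  shows "\<exists>C. \<forall>\<mu>. cmod (\<mu> - \<mu>0) \<le> 1 \<longrightarrow> (\<forall>x\<in>{0..1}. norm (Y \<mu> x - Y \<mu>0 x) \<le> C * cmod (\<mu> - \<mu>0))"
proof -
  obtain K where K: "0 < K" "(\<lambda>t. K * norm (V t - mat \<mu>0)) absolutely_integrable_on {0..1}"
    "\<And>t (y :: complex ^ 'n ^ 'n). norm ((V t - mat \<mu>0) ** y) \<le> K * norm (V t - mat \<mu>0) * norm y"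
    using coefficient_bound[OF bounded_bilinear_matrix_mult resolvent_coefficient_integrable[OF V]] by blast
  have "continuous_on {0..1} (\<lambda>x. norm (Y \<mu>0 x))"
    by (intro continuous_intros matrix_solution_continuous[OF sol])
  then obtain B where B: "\<And>t. t \<in> {0..1} \<Longrightarrow> norm (Y \<mu>0 t) \<le> B"
    using continuous_attains_sup[OF compact_Icc, of 0 1 "\<lambda>x. norm (Y \<mu>0 x)"] by fastforce
  have B0: "0 \<le> B" using B[of 0] norm_ge_zero[of "Y \<mu>0 0"] by (simp del: norm_ge_zero)
  define q where "q t = 1 + K * norm (V t - mat \<mu>0)" for t
  have q: "q absolutely_integrable_on {0..1}"
    unfolding q_def by (intro set_integral_add absolutely_integrable_continuous_real K(2)) auto
  have q0: "0 \<le> q t" for t using K(1) by (simp add: q_def)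
  have q1: "(\<lambda>t. 1 + q t) absolutely_integrable_on {0..1}"
    by (intro set_integral_add absolutely_integrable_continuous_real q) auto
  define C where "C = B * exp (integral {0..1} (\<lambda>t. 1 + q t))"
  have "norm (Y \<mu> x - Y \<mu>0 x) \<le> C * cmod (\<mu> - \<mu>0)" if \<mu>: "cmod (\<mu> - \<mu>0) \<le> 1" and x: "x \<in> {0..1}" for \<mu> x
  proof -
    define r where "r = B * cmod (\<mu> - \<mu>0)"
    have r: "0 \<le> r" using B0 by (simp add: r_def)
    have p: "primitive (Y \<mu>) (dY \<mu>)" "primitive (dY \<mu>) (\<lambda>x. (V x - mat \<mu>) ** Y \<mu> x)" for \<mu>
      using sol unfolding matrix_solution_iff by blast+
    have "norm (Y \<mu> x - Y \<mu>0 x) + norm (dY \<mu> x - dY \<mu>0 x) \<le>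
       (norm (Y \<mu> 0 - Y \<mu>0 0) + norm (dY \<mu> 0 - dY \<mu>0 0) + r) * exp (integral {0..x} (\<lambda>t. 1 + q t))"
    proof (rule second_order_bound[OF primitive_diff_fun[OF p(1) p(1)] primitive_diff_fun[OF p(2) p(2)] q q0 _ r x])
      fix t :: real assume t: "t \<in> {0..1}"
      have "mat \<mu> = mat \<mu>0 + (mat (\<mu> - \<mu>0) :: complex ^ 'n ^ 'n)" by (simp add: vec_eq_iff mat_def)
      then have "(V t - mat \<mu>) ** Y \<mu> t - (V t - mat \<mu>0) ** Y \<mu>0 t =
         (V t - mat \<mu>0) ** (Y \<mu> t - Y \<mu>0 t) - mat (\<mu> - \<mu>0) ** (Y \<mu> t - Y \<mu>0 t) - mat (\<mu> - \<mu>0) ** Y \<mu>0 t"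
        by (simp add: matrix_mult_diff_left matrix_mult_diff_right bounded_bilinear.add_left[OF bounded_bilinear_matrix_mult])
      also have "norm \<dots> \<le> norm ((V t - mat \<mu>0) ** (Y \<mu> t - Y \<mu>0 t)) + norm (mat (\<mu> - \<mu>0) ** (Y \<mu> t - Y \<mu>0 t)) + norm (mat (\<mu> - \<mu>0) ** Y \<mu>0 t)"
        by (intro order_trans[OF norm_triangle_ineq4] add_mono norm_triangle_ineq4 order_refl)
      also have "\<dots> \<le> K * norm (V t - mat \<mu>0) * norm (Y \<mu> t - Y \<mu>0 t) + 1 * norm (Y \<mu> t - Y \<mu>0 t) + cmod (\<mu> - \<mu>0) * B"
        unfolding norm_mat_mult using \<mu> B[OF t] by (intro add_mono K(3) mult_mono) auto
      finally show "norm ((V t - mat \<mu>) ** Y \<mu> t - (V t - mat \<mu>0) ** Y \<mu>0 t) \<le> q t * norm (Y \<mu> t - Y \<mu>0 t) + r"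
        by (simp add: q_def r_def algebra_simps)
    qed
    then have "norm (Y \<mu> x - Y \<mu>0 x) \<le> r * exp (integral {0..x} (\<lambda>t. 1 + q t))"
      using norm_ge_zero[of "dY \<mu> x - dY \<mu>0 x"] by (simp add: init del: norm_ge_zero)
    also have "integral {0..x} (\<lambda>t. 1 + q t) \<le> integral {0..1} (\<lambda>t. 1 + q t)"
      using x q0 by (intro integral_subset_le absolutely_integrable_subinterval(2)[OF q1]) (auto simp: add_nonneg_nonneg)
    then have "r * exp (integral {0..x} (\<lambda>t. 1 + q t)) \<le> r * exp (integral {0..1} (\<lambda>t. 1 + q t))"
      using r by (intro mult_left_mono) auto
    finally show ?thesis by (simp add: r_def C_def algebra_simps)
  qed
  then show ?thesis by blast
qed

end

section \<open>The Lagrange identity\<close>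

text \<open>By the product rule \<open>y\<^sup>* z' - y'\<^sup>* z\<close> has the density \<open>y\<^sup>* (V - \<mu>) z - ((V - \<nu>) y)\<^sup>* z\<close>, in which
  \<open>V\<close> cancels because it is Hermitian almost everywhere.\<close>
lemma lagrange_identity:
  fixes V :: "real \<Rightarrow> complex ^ 'n ^ 'n"
  assumes herm: "AE x in lebesgue_on {0<..<1}. ctranspose (V x) = V x"
    and y: "matrix_solution V \<nu> y dy" and z: "matrix_solution V \<mu> z dz"
  shows "ctranspose (y 1) ** dz 1 - ctranspose (dy 1) ** z 1 =
    ctranspose (y 0) ** dz 0 - ctranspose (dy 0) ** z 0 +
    mat (cnj \<nu> - \<mu>) ** integral {0..1} (\<lambda>x. ctranspose (y x) ** z x)"
proof -
  note bil = primitive_bilinear[OF bounded_bilinear_matrix_mult]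
    and ct = primitive_linear[OF _ bounded_linear_ctranspose]
  have py: "primitive y dy" "primitive dy (\<lambda>x. (V x - mat \<nu>) ** y x)"
    and pz: "primitive z dz" "primitive dz (\<lambda>x. (V x - mat \<mu>) ** z x)"
    using y z unfolding matrix_solution_iff by blast+
  define c where "c = cnj \<nu> - \<mu>"
  define w where "w x = ctranspose (y x) ** z x" for x
  define W where "W x = ctranspose (y x) ** dz x - ctranspose (dy x) ** z x" for x
  have "primitive W (\<lambda>x. (ctranspose (dy x) ** dz x + ctranspose (y x) ** ((V x - mat \<mu>) ** z x)) -
     (ctranspose ((V x - mat \<nu>) ** y x) ** z x + ctranspose (dy x) ** dz x))"
    unfolding W_def by (intro primitive_diff_fun bil ct py pz)
  then have W: "primitive W (\<lambda>x. mat c ** w x)"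
  proof (rule primitive_cong_AE)
    show "AE x in lebesgue_on {0<..<1}. mat c ** w x =
      (ctranspose (dy x) ** dz x + ctranspose (y x) ** ((V x - mat \<mu>) ** z x)) -
      (ctranspose ((V x - mat \<nu>) ** y x) ** z x + ctranspose (dy x) ** dz x)"
      using herm
    proof eventually_elim
      case (elim x)
      have "ctranspose (y x) ** ((V x - mat \<mu>) ** z x) - ctranspose ((V x - mat \<nu>) ** y x) ** z x
        = ctranspose (y x) ** ((V x - mat \<mu>) ** z x) - ctranspose (y x) ** ((V x - mat (cnj \<nu>)) ** z x)"
        by (simp add: ctranspose_mult elim matrix_mul_assoc)
      also have "\<dots> = ctranspose (y x) ** ((V x - mat \<mu>) ** z x - (V x - mat (cnj \<nu>)) ** z x)"
        by (simp add: matrix_mult_diff_right)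
      also have "(V x - mat \<mu>) ** z x - (V x - mat (cnj \<nu>)) ** z x = mat c ** z x"
        unfolding c_def mat_diff[symmetric] by (simp add: matrix_mult_diff_left)
      finally show ?case by (simp add: w_def mat_commute)
    qed
  qed
  have "continuous_on {0..1} w"
    unfolding w_def
    by (intro bounded_bilinear.continuous_on[OF bounded_bilinear_matrix_mult]
        bounded_linear.continuous_on[OF bounded_linear_ctranspose]
        matrix_solution_continuous[OF y] matrix_solution_continuous[OF z])
  then have "w integrable_on {0..1}" by (rule integrable_continuous_real)
  from integral_linear[OF this bounded_linear_mat_mult, of c]
  have "integral {0..1} (\<lambda>x. mat c ** w x) = mat c ** integral {0..1} w" by (simp add: o_def)
  moreover have "W 1 = W 0 + integral {0..1} (\<lambda>x. mat c ** w x)"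
    by (rule primitive_eq[OF W]) simp
  ultimately have "W 1 = W 0 + mat c ** integral {0..1} w" by simp
  then show ?thesis unfolding W_def w_def c_def .
qed

text \<open>Lagrange's identity against the solution \<open>X\<close> that is normalized at the right end, where it
  picks out \<open>- z 1\<close>; the contribution of the left end depends on the common initial data only and
  drops out of the difference.\<close>
lemma end_value_difference:
  fixes V :: "real \<Rightarrow> complex ^ 'n ^ 'n"
  assumes herm: "AE x in lebesgue_on {0<..<1}. ctranspose (V x) = V x"
    and X: "matrix_solution V (cnj \<mu>0) X dX" "X 1 = 0" "dX 1 = mat 1"
    and z: "matrix_solution V \<mu> z dz" and z0: "matrix_solution V \<mu>0 z0 dz0"
    and init: "z 0 = z0 0" "dz 0 = dz0 0"
  shows "z 1 - z0 1 = mat (\<mu> - \<mu>0) ** integral {0..1} (\<lambda>x. ctranspose (X x) ** z x)"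
proof -
  have "- z 1 = ctranspose (X 0) ** dz 0 - ctranspose (dX 0) ** z 0 +
      mat (\<mu>0 - \<mu>) ** integral {0..1} (\<lambda>x. ctranspose (X x) ** z x)"
    using lagrange_identity[OF herm X(1) z] X by (simp add: matrix_mult_zero_left)
  moreover have "- z0 1 = ctranspose (X 0) ** dz0 0 - ctranspose (dX 0) ** z0 0"
    using lagrange_identity[OF herm X(1) z0] X by (simp add: matrix_mult_zero_left)
  ultimately have "z 1 - z0 1 = - (mat (\<mu>0 - \<mu>) ** integral {0..1} (\<lambda>x. ctranspose (X x) ** z x))"
    by (simp add: init algebra_simps)
  also have "\<dots> = mat (\<mu> - \<mu>0) ** integral {0..1} (\<lambda>x. ctranspose (X x) ** z x)"
    by (simp add: vec_eq_iff algebra_simps)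
  finally show ?thesis .
qed

text \<open>The difference quotient of the end value is an integral over the solution at \<open>\<mu>\<close>, and this
  integral is continuous in \<open>\<mu>\<close>. Complex differentiability at every point thus needs no series
  expansion in the spectral parameter.\<close>
lemma end_value_has_derivative:
  fixes V :: "real \<Rightarrow> complex ^ 'n ^ 'n"
  assumes V: "V absolutely_integrable_on {0..1}"
    and herm: "AE x in lebesgue_on {0<..<1}. ctranspose (V x) = V x"
    and X: "matrix_solution V (cnj \<mu>0) X dX" "X 1 = 0" "dX 1 = mat 1"
    and sol: "\<And>\<mu>. matrix_solution V \<mu> (Y \<mu>) (dY \<mu>)" and init: "\<And>\<mu>. Y \<mu> 0 = a" "\<And>\<mu>. dY \<mu> 0 = b"
  shows "((\<lambda>\<mu>. Y \<mu> 1 $ i $ j) has_field_derivative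
     integral {0..1} (\<lambda>x. ctranspose (X x) ** Y \<mu>0 x) $ i $ j) (at \<mu>0)"
proof -
  define g where "g \<mu> = integral {0..1} (\<lambda>x. ctranspose (X x) ** Y \<mu> x)" for \<mu>
  obtain C where C: "\<And>\<mu> x. cmod (\<mu> - \<mu>0) \<le> 1 \<Longrightarrow> x \<in> {0..1} \<Longrightarrow> norm (Y \<mu> x - Y \<mu>0 x) \<le> C * cmod (\<mu> - \<mu>0)"
    using solution_family_lipschitz[OF V sol init] by blast
  obtain K where K: "0 < K" "\<And>(A :: complex ^ 'n ^ 'n) (B :: complex ^ 'n ^ 'n). norm (A ** B) \<le> norm A * norm B * K"
    using bounded_bilinear.pos_bounded[OF bounded_bilinear_matrix_mult] by blast
  have Xc: "continuous_on {0..1} (\<lambda>x. ctranspose (X x))"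
    by (intro bounded_linear.continuous_on[OF bounded_linear_ctranspose] matrix_solution_continuous[OF X(1)])
  have "continuous_on {0..1} (\<lambda>x. norm (ctranspose (X x)))"
    by (intro continuous_intros Xc)
  then obtain B where B: "\<And>t. t \<in> {0..1} \<Longrightarrow> norm (ctranspose (X t)) \<le> B"
    using continuous_attains_sup[OF compact_Icc, of 0 1 "\<lambda>x. norm (ctranspose (X x))"] by fastforce
  have int: "(\<lambda>x. ctranspose (X x) ** Y \<mu> x) integrable_on {0..1}" for \<mu>
    by (intro integrable_continuous_real bounded_bilinear.continuous_on[OF bounded_bilinear_matrix_mult]
        Xc matrix_solution_continuous[OF sol])
  have bound: "norm (g \<mu> - g \<mu>0) \<le> B * C * K * cmod (\<mu> - \<mu>0)" if "cmod (\<mu> - \<mu>0) \<le> 1" for \<mu>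
  proof -
    have "g \<mu> - g \<mu>0 = integral {0..1} (\<lambda>x. ctranspose (X x) ** Y \<mu> x - ctranspose (X x) ** Y \<mu>0 x)"
      unfolding g_def by (rule Henstock_Kurzweil_Integration.integral_diff[OF int int, symmetric])
    also have "norm \<dots> \<le> integral {0..1} (\<lambda>x::real. B * C * K * cmod (\<mu> - \<mu>0))"
    proof (rule Henstock_Kurzweil_Integration.integral_norm_bound_integral)
      show "(\<lambda>x. ctranspose (X x) ** Y \<mu> x - ctranspose (X x) ** Y \<mu>0 x) integrable_on {0..1}"
        by (intro integrable_diff int)
      fix x :: real assume x: "x \<in> {0..1}"
      have "norm (ctranspose (X x) ** Y \<mu> x - ctranspose (X x) ** Y \<mu>0 x) \<le>
        norm (ctranspose (X x)) * norm (Y \<mu> x - Y \<mu>0 x) * K"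
        unfolding matrix_mult_diff_right[symmetric] by (rule K)
      also have "\<dots> \<le> B * (C * cmod (\<mu> - \<mu>0)) * K"
        using K(1) B[OF x] C[OF that x] by (intro mult_right_mono mult_mono order_trans[OF norm_ge_zero B[OF x]]) auto
      finally show "norm (ctranspose (X x) ** Y \<mu> x - ctranspose (X x) ** Y \<mu>0 x) \<le> B * C * K * cmod (\<mu> - \<mu>0)"
        by (simp add: mult_ac)
    qed auto
    finally show ?thesis by simp
  qed
  have "((\<lambda>\<mu>. g \<mu> - g \<mu>0) \<longlongrightarrow> 0) (at \<mu>0)"
  proof (rule Lim_null_comparison)
    have "\<forall>\<^sub>F \<mu> in at \<mu>0. dist \<mu> \<mu>0 < 1" by (auto simp: eventually_at intro!: exI[of _ 1])
    then show "\<forall>\<^sub>F \<mu> in at \<mu>0. norm (g \<mu> - g \<mu>0) \<le> B * C * K * cmod (\<mu> - \<mu>0)"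
      by eventually_elim (rule bound, simp add: dist_norm)
    have "((\<lambda>\<mu>. B * C * K * cmod (\<mu> - \<mu>0)) \<longlongrightarrow> B * C * K * cmod (\<mu>0 - \<mu>0)) (at \<mu>0)"
      by (intro tendsto_intros)
    then show "((\<lambda>\<mu>. B * C * K * cmod (\<mu> - \<mu>0)) \<longlongrightarrow> 0) (at \<mu>0)" by simp
  qed
  then have "(g \<longlongrightarrow> g \<mu>0) (at \<mu>0)" by (rule LIM_zero_cancel)
  then have lim: "((\<lambda>\<mu>. g \<mu> $ i $ j) \<longlongrightarrow> g \<mu>0 $ i $ j) (at \<mu>0)" by (intro tendsto_vec_nth)
  have "((\<lambda>\<mu>. (Y \<mu> 1 $ i $ j - Y \<mu>0 1 $ i $ j) / (\<mu> - \<mu>0)) \<longlongrightarrow> g \<mu>0 $ i $ j) (at \<mu>0)"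
  proof (rule Lim_transform_eventually[OF lim])
    show "\<forall>\<^sub>F \<mu> in at \<mu>0. g \<mu> $ i $ j = (Y \<mu> 1 $ i $ j - Y \<mu>0 1 $ i $ j) / (\<mu> - \<mu>0)"
      unfolding eventually_at_filter
    proof (intro always_eventually allI impI)
      fix \<mu> assume "\<mu> \<noteq> \<mu>0"
      have "Y \<mu> 1 - Y \<mu>0 1 = mat (\<mu> - \<mu>0) ** g \<mu>"
        unfolding g_def by (rule end_value_difference[OF herm X sol sol]) (simp_all add: init)
      then have "(Y \<mu> 1 - Y \<mu>0 1) $ i $ j = (\<mu> - \<mu>0) * g \<mu> $ i $ j" by simp
      then show "g \<mu> $ i $ j = (Y \<mu> 1 $ i $ j - Y \<mu>0 1 $ i $ j) / (\<mu> - \<mu>0)"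
        using \<open>\<mu> \<noteq> \<mu>0\<close> by (simp add: field_simps)
    qed
  qed
  then show ?thesis by (simp add: has_field_derivative_iff g_def)
qed

section \<open>Orthogonal projectors\<close>

text \<open>This reduces Hermitian orthogonality to a complex subspace to orthogonality for the real inner
  product: testing with \<open>w\<close> and \<open>\<i> w\<close> gives the real and the imaginary part.\<close>
lemma Re_hinner: "Re (hinner v w) = inner v w"
  by (simp add: hinner_def inner_vec_def inner_complex_def)

lemma orthogonal_decomposition:
  fixes E :: "(complex ^ 'n) set"
  assumes E0: "0 \<in> E" and add: "\<And>u v. u \<in> E \<Longrightarrow> v \<in> E \<Longrightarrow> u + v \<in> E"
    and scale: "\<And>c v. v \<in> E \<Longrightarrow> c *s v \<in> E"
  obtains y z where "y \<in> E" "z \<in> orth_compl E" "x = y + z"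
proof -
  have "r *\<^sub>R v \<in> E" if "v \<in> E" for r v
  proof -
    have "r *\<^sub>R v = of_real r *s v" unfolding vec_eq_iff vector_smult_component vector_scaleR_component
      by (simp add: scaleR_conv_of_real)
    then show ?thesis using scale[OF that, of "of_real r"] by simp
  qed
  then have "subspace E" using E0 add by (simp add: subspace_def)
  then have span: "span E = E" by simp
  obtain y z where yz: "y \<in> E" "\<And>w. w \<in> E \<Longrightarrow> orthogonal z w" "x = y + z"
    using orthogonal_subspace_decomp_exists[of E x] unfolding span by metis
  have "hinner z w = 0" if w: "w \<in> E" for w
  proof -
    have "Re (hinner z w) = 0" using yz(2)[OF w] by (simp add: Re_hinner orthogonal_def)
    moreover have "Re (hinner z (\<i> *s w)) = 0"
      unfolding Re_hinner using yz(2)[OF scale[OF w, of \<i>]] by (simp only: orthogonal_def)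
    ultimately show ?thesis by (simp add: complex_eq_iff)
  qed
  then show thesis using that[of y z] yz by (simp add: orth_compl_def)
qed

text \<open>The orthogonal decomposition defines a complex linear map, whose matrix \<open>Q\<close> satisfies the
  defining conditions. A second candidate \<open>R\<close> has the same range, so \<open>R Q = Q\<close> and \<open>Q R = R\<close>, and
  taking adjoints shows \<open>R = Q\<close>.\<close>
lemma orth_projector_properties:
  fixes E :: "(complex ^ 'n) set"
  assumes E0: "0 \<in> E" and add: "\<And>u v. u \<in> E \<Longrightarrow> v \<in> E \<Longrightarrow> u + v \<in> E"
    and scale: "\<And>c v. v \<in> E \<Longrightarrow> c *s v \<in> E"
  defines "P \<equiv> orth_projector E"
  shows "ctranspose P = P"
    and "P *v v \<in> E"
    and "v \<in> E \<Longrightarrow> P *v v = v"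
    and "v \<in> orth_compl E \<Longrightarrow> P *v v = 0"
    and "P ** P = P"
proof -
  have neg: "- v \<in> E" if "v \<in> E" for v
    using scale[OF that, of "-1"] by (simp add: vector_sneg_minus1[symmetric])
  have "\<exists>y. y \<in> E \<and> x - y \<in> orth_compl E" for x
    using orthogonal_decomposition[OF E0 add scale, of x] by (metis add_diff_cancel_left')
  then obtain p where p: "\<And>x. p x \<in> E" "\<And>x. x - p x \<in> orth_compl E" by metis
  have uniq: "y = p x" if "y \<in> E" "x - y \<in> orth_compl E" for x y
  proof -
    have d: "y - p x \<in> E" using add[OF that(1) neg[OF p(1)[of x]]] by simp
    have "hinner (x - p x) (y - p x) = 0" "hinner (x - y) (y - p x) = 0"
      using d p(2)[of x] that(2) unfolding orth_compl_def by blast+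
    then have "hinner ((x - p x) - (x - y)) (y - p x) = 0" by (simp only: hinner_linear) simp
    then have "hinner (y - p x) (y - p x) = 0" by (simp only: diff_diff_eq2 diff_add_cancel) (simp add: algebra_simps)
    then show ?thesis by (simp only: hinner_eq_zero) simp
  qed
  have oadd: "u + v \<in> orth_compl E" if "u \<in> orth_compl E" "v \<in> orth_compl E" for u v
    using that by (simp add: orth_compl_def)
  have oscale: "c *s v \<in> orth_compl E" if "v \<in> orth_compl E" for c v
    using that by (simp add: orth_compl_def)
  have p_add: "p (u + v) = p u + p v" for u v
    by (rule uniq[symmetric]) (use add[OF p(1)[of u] p(1)[of v]] oadd[OF p(2)[of u] p(2)[of v]] in \<open>simp_all add: algebra_simps\<close>)
  have p_scale: "p (c *s v) = c *s p v" for c v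
  proof (rule uniq[symmetric])
    show "c *s p v \<in> E" by (rule scale[OF p(1)])
    show "c *s v - c *s p v \<in> orth_compl E"
      using oscale[OF p(2)[of v], of c] by (simp add: vector_ssub_ldistrib)
  qed
  have "Vector_Spaces.linear (*s) (*s) p"
    unfolding Vector_Spaces.linear_def module_hom_def module_hom_axioms_def
    using p_add p_scale by (simp add: vec.vector_space_axioms vec.module_axioms)
  then obtain Q :: "complex ^ 'n ^ 'n" where Q: "\<And>x. Q *v x = p x"
    using matrix_works by metis
  have p_fix: "p v = v" if "v \<in> E" for v
    by (rule uniq[symmetric]) (use that in \<open>auto simp: orth_compl_def\<close>)
  have QQ: "Q ** Q = Q"
    unfolding matrix_eq by (simp add: matrix_vector_mul_assoc[symmetric] Q p_fix p(1))
  have sym: "hinner (p v) w = hinner v (p w)" for v w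
  proof -
    have "hinner (v - p v) (p w) = 0" "hinner (w - p w) (p v) = 0"
      using p unfolding orth_compl_def by blast+
    then have "hinner v (p w) = hinner (p v) (p w)" "hinner w (p v) = hinner (p w) (p v)" by simp_all
    then show ?thesis by (metis hinner_commute)
  qed
  have QH: "ctranspose Q = Q"
    unfolding matrix_eq
  proof
    fix v
    show "ctranspose Q *v v = Q *v v"
      by (rule hinner_eqI) (metis Q sym hinner_matrix')
  qed
  have Qr: "range (\<lambda>v. Q *v v) = E"
    unfolding Q using p(1) p_fix by (metis image_subset_iff rangeI subsetI subset_antisym)
  have "P = Q"
    unfolding P_def orth_projector_def
  proof (rule the_equality)
    show "Q ** Q = Q \<and> ctranspose Q = Q \<and> range ((*v) Q) = E" using QQ QH Qr by blast
    fix R assume R: "R ** R = R \<and> ctranspose R = R \<and> range ((*v) R) = E"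
    have fix_R: "R *v v = v" if v: "v \<in> E" for v
    proof -
      obtain u where "v = R *v u" using R v by blast
      then show ?thesis using R by (metis matrix_vector_mul_assoc)
    qed
    have "R ** Q = Q" unfolding matrix_eq
      by (simp add: matrix_vector_mul_assoc[symmetric] Q fix_R p(1))
    moreover have "Q ** R = R" unfolding matrix_eq
      using R by (auto simp: matrix_vector_mul_assoc[symmetric] Q intro!: p_fix)
    ultimately show "R = Q" using R QH by (metis ctranspose_mult)
  qed
  moreover have "p v = 0" if "v \<in> orth_compl E"
    by (rule uniq[symmetric]) (use that E0 in simp_all)
  ultimately show "ctranspose P = P" "P *v v \<in> E" "v \<in> E \<Longrightarrow> P *v v = v"
    "v \<in> orth_compl E \<Longrightarrow> P *v v = 0" "P ** P = P"
    using QQ QH p(1) p_fix by (simp_all add: Q)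
qed

section \<open>Matrix-valued analytic functions and simple poles\<close>

lemma matrix_analytic_on_pointwise: "matrix_analytic_on M A \<longleftrightarrow> (\<forall>a\<in>A. matrix_analytic_on M {a})"
proof -
  have "(\<lambda>z. M z $ i $ j) analytic_on A \<longleftrightarrow> (\<forall>a\<in>A. (\<lambda>z. M z $ i $ j) analytic_on {a})" for i j
    by (rule analytic_on_analytic_at)
  then show ?thesis unfolding matrix_analytic_on_def by blast
qed

lemma matrix_analytic_on_const: "matrix_analytic_on (\<lambda>_. C) A"
  by (simp add: matrix_analytic_on_def)

lemma matrix_analytic_on_mult:
  assumes "matrix_analytic_on M A" "matrix_analytic_on N A"
  shows "matrix_analytic_on (\<lambda>z. M z ** N z) A"
  using assms unfolding matrix_analytic_on_def matrix_matrix_mult_def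
  by (auto intro!: analytic_on_sum analytic_on_mult)

lemma matrix_analytic_on_add:
  assumes "matrix_analytic_on M A" "matrix_analytic_on N A"
  shows "matrix_analytic_on (\<lambda>z. M z + N z) A"
  using assms unfolding matrix_analytic_on_def by (auto intro!: analytic_on_add)

lemma matrix_analytic_on_minus:
  assumes "matrix_analytic_on M A"
  shows "matrix_analytic_on (\<lambda>z. - M z) A"
  using assms unfolding matrix_analytic_on_def by (auto intro!: analytic_on_neg)

lemma analytic_on_det:
  assumes "matrix_analytic_on M A"
  shows "(\<lambda>z. det (M z)) analytic_on A"
  using assms unfolding matrix_analytic_on_def det_def
  by (auto intro!: analytic_on_sum analytic_on_mult analytic_on_prod)

lemma matrix_inverse_uniqueI:
  fixes A B :: "complex ^ 'n ^ 'n"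
  assumes "B ** A = mat 1"
  shows "matrix_inv A = B" "det A \<noteq> 0"
proof -
  have "A ** B = mat 1" using assms matrix_left_right_inverse by blast
  then have ex: "A ** B = mat 1 \<and> B ** A = mat 1" using assms by blast
  then have "A ** matrix_inv A = mat 1 \<and> matrix_inv A ** A = mat 1"
    unfolding matrix_inv_def by (rule someI)
  then show "matrix_inv A = B"
    by (metis assms matrix_mul_assoc matrix_mul_lid matrix_mul_rid)
  show "det A \<noteq> 0" using ex invertible_det_nz invertible_def by blast
qed

lemma matrix_inv_both:
  fixes A :: "complex ^ 'n ^ 'n"
  assumes "det A \<noteq> 0"
  shows "A ** matrix_inv A = mat 1" "matrix_inv A ** A = mat 1"
proof -
  obtain B where "A ** B = mat 1 \<and> B ** A = mat 1"
    using assms invertible_det_nz invertible_def by blast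
  then have "A ** matrix_inv A = mat 1 \<and> matrix_inv A ** A = mat 1"
    unfolding matrix_inv_def by (rule someI)
  then show "A ** matrix_inv A = mat 1" "matrix_inv A ** A = mat 1" by blast+
qed

lemma det_nonzero_iff_kernel:
  fixes A :: "complex ^ 'n ^ 'n"
  shows "det A \<noteq> 0 \<longleftrightarrow> (\<forall>v. A *v v = 0 \<longrightarrow> v = 0)"
  using matrix_left_invertible_ker[of A] matrix_inverse_uniqueI(2)[of _ A] matrix_inv_both(2)[of A] by blast

text \<open>Cramer's rule exhibits the entries of the inverse as quotients of polynomials in the entries, which
  makes inversion analytic.\<close>
lemma matrix_inv_cramer:
  fixes A :: "complex ^ 'n ^ 'n"
  assumes "det A \<noteq> 0"
  shows "matrix_inv A $ k $ j = det (\<chi> i l. if l = k then axis j 1 $ i else A $ i $ l) / det A"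
proof -
  have "A *v (matrix_inv A *v axis j 1) = axis j 1"
    by (simp add: matrix_vector_mul_assoc matrix_inv_both[OF assms])
  then have "matrix_inv A *v axis j 1 = (\<chi> k. det (\<chi> i l. if l = k then axis j 1 $ i else A $ i $ l) / det A)"
    using cramer[OF assms] by blast
  moreover have "(matrix_inv A *v axis j 1) $ k = matrix_inv A $ k $ j"
    by (simp add: matrix_vector_mult_def axis_def if_distrib sum.delta cong: if_cong)
  ultimately show ?thesis by simp
qed

lemma det_eventually_nonzero:
  assumes "matrix_analytic_on M {a}" "det (M a) \<noteq> 0"
  shows "\<forall>\<^sub>F z in nhds a. det (M z) \<noteq> 0"
  using analytic_at_neq_imp_eventually_neq[OF analytic_on_det[OF assms(1)], of 0] assms(2)
  by (auto simp: eventually_at_filter elim!: eventually_mono)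

lemma matrix_analytic_on_inv:
  fixes M :: "complex \<Rightarrow> complex ^ 'n ^ 'n"
  assumes M: "matrix_analytic_on M {a}" and nz: "det (M a) \<noteq> 0"
  shows "matrix_analytic_on (\<lambda>z. matrix_inv (M z)) {a}"
  unfolding matrix_analytic_on_def
proof (intro allI)
  fix k j :: 'n
  define N where "N z = (\<chi> i l. if l = k then axis j 1 $ i else M z $ i $ l)" for z
  have "matrix_analytic_on N {a}"
    unfolding matrix_analytic_on_def
  proof (intro allI)
    fix i l
    show "(\<lambda>z. N z $ i $ l) analytic_on {a}"
      using M by (cases "l = k") (simp_all add: N_def matrix_analytic_on_def)
  qed
  then have "(\<lambda>z. det (N z) / det (M z)) analytic_on {a}"
    using nz by (intro analytic_on_divide analytic_on_det M) auto
  moreover have "\<forall>\<^sub>F z in nhds a. matrix_inv (M z) $ k $ j = det (N z) / det (M z)"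
    using det_eventually_nonzero[OF assms]
    by eventually_elim (simp add: matrix_inv_cramer N_def)
  ultimately show "(\<lambda>z. matrix_inv (M z) $ k $ j) analytic_on {a}"
    by (simp only: analytic_at_cong[OF _ refl])
qed

text \<open>The difference quotient is analytic once the value at \<open>a\<close> is filled in by the derivative.\<close>
lemma matrix_analytic_quotient:
  fixes F :: "complex \<Rightarrow> complex ^ 'k ^ 'n"
  assumes F: "matrix_analytic_on F {a}"
  shows "matrix_analytic_on (\<lambda>z. if z = a then \<chi> i j. deriv (\<lambda>z. F z $ i $ j) a else mat (inverse (z - a)) ** (F z - F a)) {a}"
  unfolding matrix_analytic_on_def
proof (intro allI)
  fix i j
  define f where "f z = F z $ i $ j" for z
  have "f analytic_on {a}" using F unfolding matrix_analytic_on_def f_def by blast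
  then obtain S where S: "open S" "a \<in> S" "f holomorphic_on S" by (auto simp: analytic_at)
  then have "(\<lambda>z. if z = a then deriv f a else (f z - f a) / (z - a)) holomorphic_on S"
    by (intro pole_lemma) (auto simp: interior_open)
  then have "(\<lambda>z. if z = a then deriv f a else (f z - f a) / (z - a)) analytic_on {a}"
    using S holomorphic_on_imp_analytic_at by blast
  moreover have "(\<lambda>z. (if z = a then \<chi> i j. deriv (\<lambda>z. F z $ i $ j) a else mat (inverse (z - a)) ** (F z - F a)) $ i $ j)
     = (\<lambda>z. if z = a then deriv f a else (f z - f a) / (z - a))"
    by (auto simp: fun_eq_iff f_def[abs_def] divide_inverse mult.commute)
  ultimately show "(\<lambda>z. (if z = a then \<chi> i j. deriv (\<lambda>z. F z $ i $ j) a else mat (inverse (z - a)) ** (F z - F a)) $ i $ j) analytic_on {a}"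
    by simp
qed

lemma matrix_analytic_expand:
  fixes A :: "complex \<Rightarrow> complex ^ 'k ^ 'n"
  assumes "matrix_analytic_on A {a}"
  obtains B where "matrix_analytic_on B {a}"
    "\<And>z. z \<noteq> a \<Longrightarrow> mat (inverse (z - a)) ** A z = mat (inverse (z - a)) ** A a + B z"
  using matrix_analytic_quotient[OF assms]
  by (rule that) (simp add: matrix_mult_diff_right)

text \<open>If \<open>F a ** P = 0\<close>, then \<open>F z ** P\<close> is \<open>z - a\<close> times an analytic function with value \<open>D ** P\<close> at \<open>a\<close>.
  Hence \<open>F z = K z ** (mat 1 - P + (z - a) P)\<close> with \<open>K\<close> analytic and \<open>K a = F a + D ** P\<close>. The second
  factor has the explicit inverse \<open>mat 1 - P + (z - a)\<inverse> P\<close>; if \<open>K a\<close> is invertible, this is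
  the only source of a singularity. It also shows that \<open>F\<close> is invertible on a punctured neighbourhood.\<close>
lemma simple_pole_of_inverse:
  fixes F :: "complex \<Rightarrow> complex ^ 'n ^ 'n"
  assumes F: "matrix_analytic_on F {a}" and \<Theta>: "matrix_analytic_on \<Theta> {a}"
    and D: "\<And>i j. ((\<lambda>z. F z $ i $ j) has_field_derivative D $ i $ j) (at a)"
    and P: "P ** P = P" and FP: "F a ** P = 0"
    and nz: "det (F a + D ** P) \<noteq> 0"
  obtains G where "matrix_analytic_on G {a}"
    "\<forall>\<^sub>F z in at a. det (F z) \<noteq> 0 \<and>
       matrix_inv (F z) ** \<Theta> z = mat (inverse (z - a)) ** (P ** matrix_inv (F a + D ** P) ** \<Theta> a) + G z"
proof -
  define Q where "Q z = (if z = a then D else mat (inverse (z - a)) ** (F z - F a))" for z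
  have deriv_eq: "(\<chi> i j. deriv (\<lambda>z. F z $ i $ j) a) = D"
    using DERIV_imp_deriv[OF D] by (simp add: vec_eq_iff)
  have Q: "matrix_analytic_on Q {a}"
    using matrix_analytic_quotient[OF F] unfolding Q_def deriv_eq .
  define K where "K z = F z ** (mat 1 - P) + Q z ** P" for z
  have K: "matrix_analytic_on K {a}"
    unfolding K_def by (intro matrix_analytic_on_add matrix_analytic_on_mult F Q matrix_analytic_on_const)
  have Ka: "K a = F a + D ** P"
    by (simp add: K_def Q_def matrix_mult_diff_right FP)
  then have nzK: "det (K a) \<noteq> 0" using nz by simp
  note Kinv = matrix_analytic_on_inv[OF K nzK]
  \<comment> \<open>The projector complementary to \<open>P\<close>.\<close>
  define R where "R = mat 1 - P"
  have PR: "P ** R = 0" "R ** P = 0" "R ** R = R" "R + P = mat 1"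
    by (simp_all add: R_def matrix_mult_diff_left matrix_mult_diff_right P)
  have "matrix_analytic_on (\<lambda>z. P ** matrix_inv (K z) ** \<Theta> z) {a}"
    by (intro matrix_analytic_on_mult matrix_analytic_on_const Kinv \<Theta>)
  from matrix_analytic_expand[OF this] obtain B where B: "matrix_analytic_on B {a}"
    "\<And>z. z \<noteq> a \<Longrightarrow> mat (inverse (z - a)) ** (P ** matrix_inv (K z) ** \<Theta> z) =
       mat (inverse (z - a)) ** (P ** matrix_inv (K a) ** \<Theta> a) + B z"
    by blast
  define G where "G z = R ** matrix_inv (K z) ** \<Theta> z + B z" for z
  have G: "matrix_analytic_on G {a}"
    unfolding G_def by (intro matrix_analytic_on_add matrix_analytic_on_mult matrix_analytic_on_const Kinv \<Theta> B)
  have ev: "\<forall>\<^sub>F z in at a. z \<noteq> a \<and> det (K z) \<noteq> 0"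
    unfolding eventually_at_filter using det_eventually_nonzero[OF K nzK] by (auto elim: eventually_mono)
  have "\<forall>\<^sub>F z in at a. det (F z) \<noteq> 0 \<and>
     matrix_inv (F z) ** \<Theta> z = mat (inverse (z - a)) ** (P ** matrix_inv (F a + D ** P) ** \<Theta> a) + G z"
    using ev
  proof eventually_elim
    case (elim z)
    define c where "c = z - a"
    have c: "c \<noteq> 0" using elim by (simp add: c_def)
    have mat_inv: "mat (inverse c) ** (mat c ** A) = A" "mat c ** (mat (inverse c) ** A) = A" for A :: "complex ^ 'n ^ 'n"
      using c by (simp_all add: vec_eq_iff)
    have QP: "mat c ** (Q z ** P) = F z ** P"
    proof -
      have "mat c ** (Q z ** P) = mat c ** (mat (inverse c) ** ((F z - F a) ** P))"
        using elim by (simp add: Q_def c_def matrix_mul_assoc)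
      also have "\<dots> = F z ** P" by (simp only: mat_inv) (simp add: matrix_mult_diff_left FP)
      finally show ?thesis .
    qed
    have "K z ** (R + mat c ** P) = F z ** (R ** R) + mat c ** (F z ** (R ** P)) + (Q z ** (P ** R) + mat c ** (Q z ** (P ** P)))"
      unfolding K_def R_def[symmetric]
      by (simp only: matrix_add_ldistrib bounded_bilinear.add_left[OF bounded_bilinear_matrix_mult]
           matrix_mul_assoc[symmetric] mat_commute) (simp add: ac_simps)
    also have "\<dots> = F z ** R + mat c ** (Q z ** P)"
      by (simp add: PR P matrix_mult_zero_right)
    also have "\<dots> = F z ** (R + P)" by (simp add: QP matrix_add_ldistrib)
    finally have fact: "F z = K z ** (R + mat c ** P)" by (simp add: PR)
    define L where "L = (R + mat (inverse c) ** P) ** matrix_inv (K z)"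
    have "L ** F z = (R + mat (inverse c) ** P) ** ((matrix_inv (K z) ** K z) ** (R + mat c ** P))"
      unfolding L_def fact by (simp add: matrix_mul_assoc)
    also have "\<dots> = (R + mat (inverse c) ** P) ** (R + mat c ** P)"
      using elim by (simp add: matrix_inv_both)
    also have "\<dots> = R ** R + mat c ** (R ** P) + (mat (inverse c) ** (P ** R) + mat (inverse c) ** (mat c ** (P ** P)))"
      by (simp only: matrix_add_ldistrib bounded_bilinear.add_left[OF bounded_bilinear_matrix_mult]
           matrix_mul_assoc[symmetric] mat_commute[of R] mat_commute[of P]) (simp only: ac_simps)
    also have "\<dots> = mat 1" by (simp only: PR P mat_inv matrix_mult_zero_right) (simp add: PR)
    finally have inv: "matrix_inv (F z) = L" "det (F z) \<noteq> 0"
      using matrix_inverse_uniqueI by blast+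
    have "L ** \<Theta> z = R ** matrix_inv (K z) ** \<Theta> z + mat (inverse c) ** (P ** matrix_inv (K z) ** \<Theta> z)"
      unfolding L_def by (simp only: bounded_bilinear.add_left[OF bounded_bilinear_matrix_mult] matrix_mul_assoc)
    also have "\<dots> = mat (inverse c) ** (P ** matrix_inv (K a) ** \<Theta> a) + G z"
      using B(2)[of z] elim by (simp add: G_def c_def algebra_simps)
    finally show ?case using inv by (simp add: Ka c_def)
  qed
  then show thesis using that G by blast
qed

lemma matrix_residue_simple_pole:
  fixes M :: "complex \<Rightarrow> complex ^ 'n ^ 'n"
  assumes G: "matrix_analytic_on G {a}"
    and M: "\<forall>\<^sub>F z in at a. M z = mat (inverse (z - a)) ** R + G z"
  shows "matrix_residue M a = R"
proof -
  have "residue (\<lambda>z. M z $ i $ j) a = R $ i $ j" for i j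
  proof -
    have "(\<lambda>z. G z $ i $ j) analytic_on {a}" using G unfolding matrix_analytic_on_def by blast
    then obtain S where S: "open S" "a \<in> S" "(\<lambda>z. G z $ i $ j) holomorphic_on S" by (auto simp: analytic_at)
    define f where "f z = R $ i $ j + (z - a) * G z $ i $ j" for z
    have "residue (\<lambda>z. M z $ i $ j) a = residue (\<lambda>z. f z / (z - a)) a"
    proof (rule residue_cong[OF _ refl])
      have "\<forall>\<^sub>F z in at a. z \<noteq> a" by (simp add: eventually_at_filter)
      with M show "\<forall>\<^sub>F z in at a. M z $ i $ j = f z / (z - a)"
        by eventually_elim (simp add: f_def field_simps)
    qed
    also have "\<dots> = f a"
      using S(3) by (intro residue_simple[OF S(1,2)]) (auto simp: f_def[abs_def] intro!: holomorphic_intros)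
    finally show ?thesis by (simp add: f_def)
  qed
  then show ?thesis by (simp add: matrix_residue_def vec_eq_iff)
qed

section \<open>The Weyl--Titchmarsh function\<close>

text \<open>The solution with the data complementary to those of \<open>phi\<close>; together they form a fundamental
  system.\<close>
definition theta ::
    "(real \<Rightarrow> complex ^ 'n ^ 'n) \<Rightarrow> real \<Rightarrow> complex \<Rightarrow> complex ^ 'n ^ 'n" where
  "theta V x \<mu> = (SOME y. \<exists>dy. matrix_solution V \<mu> y dy \<and> y 0 = mat 1 \<and> dy 0 = 0) x"

lemma eigen_ker_subspace:
  "0 \<in> eigen_ker V \<mu>" "u \<in> eigen_ker V \<mu> \<Longrightarrow> v \<in> eigen_ker V \<mu> \<Longrightarrow> u + v \<in> eigen_ker V \<mu>"
  "v \<in> eigen_ker V \<mu> \<Longrightarrow> c *s v \<in> eigen_ker V \<mu>"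
  by (simp_all add: eigen_ker_def matrix_vector_right_distrib vector_scalar_commute)

lemma eigen_projector:
  fixes V \<mu>
  defines "P \<equiv> orth_projector (eigen_ker V \<mu>)"
  shows "ctranspose P = P" "P *v v \<in> eigen_ker V \<mu>" "v \<in> eigen_ker V \<mu> \<Longrightarrow> P *v v = v"
    "v \<in> orth_compl (eigen_ker V \<mu>) \<Longrightarrow> P *v v = 0" "P ** P = P"
  unfolding P_def
  using orth_projector_properties[of "eigen_ker V \<mu>"] eigen_ker_subspace[where V = V and \<mu> = \<mu>] by blast+

lemma bounded_linear_hinner_matrix:
  "bounded_linear (\<lambda>M :: complex ^ 'n ^ 'm. hinner (M *v v) w)"
  by (rule bounded_linear_compose[OF bounded_linear_hinner_left
        bounded_bilinear.bounded_linear_left[OF bounded_bilinear_matrix_vector_mult]])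

text \<open>Matrix integrals are evaluated through their sesquilinear forms.\<close>
lemma hinner_integral:
  fixes M :: "real \<Rightarrow> complex ^ 'n ^ 'm"
  assumes "M integrable_on S"
  shows "hinner (integral S M *v v) w = integral S (\<lambda>t. hinner (M t *v v) w)"
  using integral_linear[OF assms bounded_linear_hinner_matrix] by (simp add: o_def)

context
  fixes V :: "real \<Rightarrow> complex ^ 'n ^ 'n"
  assumes V: "V absolutely_integrable_on {0..1}"
    and herm: "AE x in lebesgue_on {0<..<1}. ctranspose (V x) = V x"
begin

lemma phi_family: "\<exists>d\<phi>. \<forall>\<mu>. matrix_solution V \<mu> (\<lambda>x. phi V x \<mu>) (d\<phi> \<mu>) \<and> phi V 0 \<mu> = 0 \<and> d\<phi> \<mu> 0 = mat 1"
proof (rule choice, rule allI)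
  fix \<mu>
  show "\<exists>dy. matrix_solution V \<mu> (\<lambda>x. phi V x \<mu>) dy \<and> phi V 0 \<mu> = 0 \<and> dy 0 = mat 1"
    unfolding phi_def by (rule someI_ex[OF matrix_solution_exists_left[OF V]])
qed

lemma theta_family: "\<exists>d\<theta>. \<forall>\<mu>. matrix_solution V \<mu> (\<lambda>x. theta V x \<mu>) (d\<theta> \<mu>) \<and> theta V 0 \<mu> = mat 1 \<and> d\<theta> \<mu> 0 = 0"
proof (rule choice, rule allI)
  fix \<mu>
  show "\<exists>dy. matrix_solution V \<mu> (\<lambda>x. theta V x \<mu>) dy \<and> theta V 0 \<mu> = mat 1 \<and> dy 0 = 0"
    unfolding theta_def by (rule someI_ex[OF matrix_solution_exists_left[OF V]])
qed

lemma chi_family: "\<exists>d\<chi>. \<forall>\<mu>. matrix_solution V \<mu> (\<lambda>x. chi V x \<mu>) (d\<chi> \<mu>) \<and> chi V 1 \<mu> = 0 \<and> d\<chi> \<mu> 1 = mat 1"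
proof (rule choice, rule allI)
  fix \<mu>
  show "\<exists>dy. matrix_solution V \<mu> (\<lambda>x. chi V x \<mu>) dy \<and> chi V 1 \<mu> = 0 \<and> dy 1 = mat 1"
    unfolding chi_def by (rule someI_ex[OF matrix_solution_exists_right[OF V]])
qed

lemma phi_mult_vector_zero:
  assumes "\<And>x. x \<in> {0..1} \<Longrightarrow> phi V x \<mu> *v v = 0"
  shows "v = 0"
proof -
  obtain d\<phi> where d\<phi>: "matrix_solution V \<mu> (\<lambda>x. phi V x \<mu>) (d\<phi> \<mu>)" "d\<phi> \<mu> 0 = mat 1"
    using phi_family by blast
  show ?thesis
    using vector_solution_vanishing_derivative[OF matrix_solution_mult_vector[OF d\<phi>(1), of v] assms, of 0] d\<phi>(2)
    by simp
qed

text \<open>A solution that vanishes at \<open>0\<close> is \<open>phi\<close> times the vector of its derivative at \<open>0\<close>, so the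
  eigenfunctions correspond to the kernel of \<open>phi V 1 \<mu>\<close>.\<close>
lemma not_eigenvalue_iff_det_phi: "\<mu> \<notin> eigenvalues V \<longleftrightarrow> det (phi V 1 \<mu>) \<noteq> 0"
proof -
  obtain d\<phi> where d\<phi>: "matrix_solution V \<mu> (\<lambda>x. phi V x \<mu>) (d\<phi> \<mu>)" "phi V 0 \<mu> = 0" "d\<phi> \<mu> 0 = mat 1"
    using phi_family by blast
  note sol = matrix_solution_mult_vector[OF d\<phi>(1)]
  have "\<mu> \<in> eigenvalues V \<longleftrightarrow> (\<exists>v. phi V 1 \<mu> *v v = 0 \<and> v \<noteq> 0)"
  proof
    assume "\<mu> \<in> eigenvalues V"
    then obtain \<psi> d\<psi> where \<psi>: "vector_solution V \<mu> \<psi> d\<psi>" "\<psi> 0 = 0" "\<psi> 1 = 0" "\<exists>x\<in>{0..1}. \<psi> x \<noteq> 0"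
      unfolding eigenvalues_iff by blast
    have eq: "\<psi> x = phi V x \<mu> *v d\<psi> 0" if "x \<in> {0..1}" for x
      by (rule vector_solution_unique[OF V \<psi>(1) sol _ _ that]) (simp_all add: \<psi> d\<phi>)
    then have "d\<psi> 0 \<noteq> 0" using \<psi>(4) by force
    moreover have "phi V 1 \<mu> *v d\<psi> 0 = 0" using eq[of 1] \<psi>(3) by simp
    ultimately show "\<exists>v. phi V 1 \<mu> *v v = 0 \<and> v \<noteq> 0" by blast
  next
    assume "\<exists>v. phi V 1 \<mu> *v v = 0 \<and> v \<noteq> 0"
    then obtain v where v: "phi V 1 \<mu> *v v = 0" "v \<noteq> 0" by blast
    then have "\<exists>x\<in>{0..1}. phi V x \<mu> *v v \<noteq> 0" using phi_mult_vector_zero by blast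
    then show "\<mu> \<in> eigenvalues V"
      unfolding eigenvalues_iff
      by (intro exI[of _ "\<lambda>x. phi V x \<mu> *v v"] exI[of _ "\<lambda>x. d\<phi> \<mu> x *v v"]) (simp add: sol v d\<phi>)
  qed
  then show ?thesis unfolding det_nonzero_iff_kernel by blast
qed

text \<open>A vector in the kernel of \<open>chi V 0 \<mu>\<close> also produces a solution with Dirichlet conditions at both
  ends.\<close>
lemma det_chi_nonzero:
  assumes "\<mu> \<notin> eigenvalues V"
  shows "det (chi V 0 \<mu>) \<noteq> 0"
  unfolding det_nonzero_iff_kernel
proof (intro allI impI)
  fix v assume v: "chi V 0 \<mu> *v v = 0"
  obtain d\<chi> where d\<chi>: "matrix_solution V \<mu> (\<lambda>x. chi V x \<mu>) (d\<chi> \<mu>)" "chi V 1 \<mu> = 0" "d\<chi> \<mu> 1 = mat 1"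
    using chi_family by blast
  note sol = matrix_solution_mult_vector[OF d\<chi>(1), of v]
  have "chi V x \<mu> *v v = 0" if "x \<in> {0..1}" for x
  proof (rule ccontr)
    assume "chi V x \<mu> *v v \<noteq> 0"
    then have "\<mu> \<in> eigenvalues V"
      unfolding eigenvalues_iff using that
      by (intro exI[of _ "\<lambda>x. chi V x \<mu> *v v"] exI[of _ "\<lambda>x. d\<chi> \<mu> x *v v"]) (auto simp: sol v d\<chi>)
    then show False using assms by blast
  qed
  from vector_solution_vanishing_derivative[OF sol this, of 1] show "v = 0" by (simp add: d\<chi>)
qed

text \<open>In terms of the fundamental system, \<open>\<chi> = \<phi> A + \<theta> B\<close> with \<open>A = \<chi>'(0)\<close> and \<open>B = \<chi>(0)\<close>. The value
  at the right end, which is zero, relates \<open>A\<close> and \<open>B\<close>.\<close>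
lemma weyl_titchmarsh_formula:
  assumes \<mu>: "\<mu> \<notin> eigenvalues V"
  shows "weyl_titchmarsh V \<mu> = - (matrix_inv (phi V 1 \<mu>) ** theta V 1 \<mu>)"
proof -
  obtain d\<phi> where \<phi>: "matrix_solution V \<mu> (\<lambda>x. phi V x \<mu>) (d\<phi> \<mu>)" "phi V 0 \<mu> = 0" "d\<phi> \<mu> 0 = mat 1"
    using phi_family by blast
  obtain d\<theta> where \<theta>: "matrix_solution V \<mu> (\<lambda>x. theta V x \<mu>) (d\<theta> \<mu>)" "theta V 0 \<mu> = mat 1" "d\<theta> \<mu> 0 = 0"
    using theta_family by blast
  obtain d\<chi> where \<chi>: "matrix_solution V \<mu> (\<lambda>x. chi V x \<mu>) (d\<chi> \<mu>)" "chi V 1 \<mu> = 0"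
    using chi_family by blast
  define A B where "A = d\<chi> \<mu> 0" and "B = chi V 0 \<mu>"
  have "chi V 1 \<mu> = phi V 1 \<mu> ** A + theta V 1 \<mu> ** B"
    by (rule matrix_solution_unique[OF V \<chi>(1) matrix_solution_add[OF matrix_solution_mult_right[OF \<phi>(1)]
          matrix_solution_mult_right[OF \<theta>(1)]]]) (simp_all add: \<phi> \<theta> matrix_mult_zero_left A_def B_def)
  then have "phi V 1 \<mu> ** A = - (theta V 1 \<mu> ** B)"
    using \<chi>(2) by (simp add: eq_neg_iff_add_eq_0)
  then have "matrix_inv (phi V 1 \<mu>) ** (phi V 1 \<mu> ** A) ** matrix_inv B
      = matrix_inv (phi V 1 \<mu>) ** (- (theta V 1 \<mu> ** B)) ** matrix_inv B" by simp
  also have "\<dots> = - (matrix_inv (phi V 1 \<mu>) ** theta V 1 \<mu> ** (B ** matrix_inv B))"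
    by (simp add: matrix_mult_minus_left matrix_mult_minus_right matrix_mul_assoc)
  also have "\<dots> = - (matrix_inv (phi V 1 \<mu>) ** theta V 1 \<mu>)"
    using det_chi_nonzero[OF \<mu>] by (simp add: B_def matrix_inv_both)
  also have "matrix_inv (phi V 1 \<mu>) ** (phi V 1 \<mu> ** A) ** matrix_inv B = A ** matrix_inv B"
    using \<mu> unfolding not_eigenvalue_iff_det_phi by (simp add: matrix_mul_assoc matrix_inv_both)
  also have "A ** matrix_inv B = weyl_titchmarsh V \<mu>"
    unfolding weyl_titchmarsh_def A_def B_def
    using vector_derivative_within_closed_interval[OF zero_less_one _ matrix_solution_derivative[OF \<chi>(1)], of 0]
    by simp
  finally show ?thesis .
qed

text \<open>The form \<open>\<langle>S v, v\<rangle>\<close> is the squared \<open>L\<^sup>2\<close> norm of the solution \<open>phi v\<close>, whose derivative at \<open>0\<close>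
  is \<open>v\<close>.\<close>
lemma S_positive:
  assumes "hinner (S_mat V \<mu> *v v) v = 0"
  shows "v = 0"
proof -
  obtain d\<phi> where \<phi>: "matrix_solution V \<mu> (\<lambda>x. phi V x \<mu>) (d\<phi> \<mu>)" "phi V 0 \<mu> = 0" "d\<phi> \<mu> 0 = mat 1"
    using phi_family by blast
  note cont = matrix_solution_continuous(1)[OF \<phi>(1)]
  have int: "(\<lambda>t. ctranspose (phi V t \<mu>) ** phi V t \<mu>) integrable_on {0..1}"
    by (intro integrable_continuous_real bounded_bilinear.continuous_on[OF bounded_bilinear_matrix_mult]
        bounded_linear.continuous_on[OF bounded_linear_ctranspose] cont)
  have cont': "continuous_on {0..1} (\<lambda>t. (norm (phi V t \<mu> *v v))\<^sup>2)"
    by (intro continuous_intros bounded_linear.continuous_on[OF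
        bounded_bilinear.bounded_linear_left[OF bounded_bilinear_matrix_vector_mult]] cont)
  have "hinner (S_mat V \<mu> *v v) v = integral {0..1} (\<lambda>t. complex_of_real ((norm (phi V t \<mu> *v v))\<^sup>2))"
    unfolding S_mat_def hinner_integral[OF int]
    by (simp add: matrix_vector_mul_assoc[symmetric] hinner_matrix hinner_self del: of_real_power)
  also have "\<dots> = complex_of_real (integral {0..1} (\<lambda>t. (norm (phi V t \<mu> *v v))\<^sup>2))"
    using integral_linear[OF integrable_continuous_real[OF cont'] bounded_linear_of_real]
    by (simp add: o_def)
  finally have "integral {0..1} (\<lambda>t. (norm (phi V t \<mu> *v v))\<^sup>2) = 0"
    using assms of_real_eq_0_iff by metis
  then have "\<forall>t\<in>{0..1}. (norm (phi V t \<mu> *v v))\<^sup>2 = 0"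
    using integral_eq_0_iff[OF cont'] by simp
  then have "phi V t \<mu> *v v = 0" if "t \<in> {0..1}" for t using that by simp
  then show ?thesis by (rule phi_mult_vector_zero)
qed

text \<open>For \<open>v\<close> in the kernel both boundary terms of Lagrange's identity for \<open>phi\<close> with itself vanish,
  which leaves \<open>(cnj \<mu> - \<mu>) \<langle>S v, v\<rangle> = 0\<close>.\<close>
lemma eigenvalue_real:
  assumes "\<mu> \<in> eigenvalues V"
  shows "cnj \<mu> = \<mu>"
proof -
  obtain d\<phi> where \<phi>: "matrix_solution V \<mu> (\<lambda>x. phi V x \<mu>) (d\<phi> \<mu>)" "phi V 0 \<mu> = 0" "d\<phi> \<mu> 0 = mat 1"
    using phi_family by blast
  obtain v where v: "phi V 1 \<mu> *v v = 0" "v \<noteq> 0"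
    using assms not_eigenvalue_iff_det_phi det_nonzero_iff_kernel by blast
  have "ctranspose (phi V 1 \<mu>) ** d\<phi> \<mu> 1 - ctranspose (d\<phi> \<mu> 1) ** phi V 1 \<mu> = mat (cnj \<mu> - \<mu>) ** S_mat V \<mu>"
    using lagrange_identity[OF herm \<phi>(1) \<phi>(1)]
    by (simp add: \<phi> S_mat_def matrix_mult_zero_left matrix_mult_zero_right)
  then have "hinner ((ctranspose (phi V 1 \<mu>) ** d\<phi> \<mu> 1 - ctranspose (d\<phi> \<mu> 1) ** phi V 1 \<mu>) *v v) v
     = hinner ((mat (cnj \<mu> - \<mu>) ** S_mat V \<mu>) *v v) v" by simp
  then have "(cnj \<mu> - \<mu>) * hinner (S_mat V \<mu> *v v) v = 0"
    by (auto simp: matrix_vector_mult_diff_rdistrib matrix_vector_mul_assoc[symmetric]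
        hinner_matrix[of "ctranspose M" for M] v mat_vector_mult)
  then show ?thesis using S_positive v(2) by auto
qed

text \<open>Lagrange's identity for \<open>chi\<close> at \<open>cnj \<mu>\<close> and at \<open>\<mu>\<close> has no integral term and no contribution
  from the right end, so it states \<open>\<chi>(0,cnj \<mu>)\<^sup>* \<chi>'(0,\<mu>) = \<chi>'(0,cnj \<mu>)\<^sup>* \<chi>(0,\<mu>)\<close>.\<close>
lemma weyl_titchmarsh_symmetric:
  assumes \<mu>: "\<mu> \<notin> eigenvalues V"
  shows "weyl_titchmarsh V \<mu> = ctranspose (weyl_titchmarsh V (cnj \<mu>))"
proof -
  have \<mu>': "cnj \<mu> \<notin> eigenvalues V" using \<mu> eigenvalue_real[of "cnj \<mu>"] by auto
  obtain d\<chi> where \<chi>: "\<And>\<mu>. matrix_solution V \<mu> (\<lambda>x. chi V x \<mu>) (d\<chi> \<mu>)" "\<And>\<mu>. chi V 1 \<mu> = 0"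
    using chi_family by blast
  have m: "weyl_titchmarsh V \<mu> = d\<chi> \<mu> 0 ** matrix_inv (chi V 0 \<mu>)" for \<mu>
    unfolding weyl_titchmarsh_def
    using vector_derivative_within_closed_interval[OF zero_less_one _ matrix_solution_derivative[OF \<chi>(1)], of 0]
    by simp
  define B C where "B = chi V 0 \<mu>" and "C = chi V 0 (cnj \<mu>)"
  have inv: "B ** matrix_inv B = mat 1" "C ** matrix_inv C = mat 1"
    using det_chi_nonzero[OF \<mu>] det_chi_nonzero[OF \<mu>'] by (simp_all add: B_def C_def matrix_inv_both)
  have mat0: "mat 0 ** A = 0" for A :: "complex ^ 'n ^ 'n" by (simp add: vec_eq_iff)
  have "ctranspose C ** d\<chi> \<mu> 0 = ctranspose (d\<chi> (cnj \<mu>) 0) ** B"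
    using lagrange_identity[OF herm \<chi>(1)[of "cnj \<mu>"] \<chi>(1)[of \<mu>]]
    by (simp add: \<chi>(2) B_def C_def matrix_mult_zero_left matrix_mult_zero_right mat0)
  then have "ctranspose (matrix_inv C) ** (ctranspose C ** d\<chi> \<mu> 0) ** matrix_inv B
      = ctranspose (matrix_inv C) ** (ctranspose (d\<chi> (cnj \<mu>) 0) ** B) ** matrix_inv B" by simp
  also have "\<dots> = ctranspose (matrix_inv C) ** ctranspose (d\<chi> (cnj \<mu>) 0) ** (B ** matrix_inv B)"
    by (simp add: matrix_mul_assoc)
  also have "\<dots> = ctranspose (weyl_titchmarsh V (cnj \<mu>))"
    by (simp add: inv m C_def ctranspose_mult)
  also have "ctranspose (matrix_inv C) ** (ctranspose C ** d\<chi> \<mu> 0) ** matrix_inv B =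
     ctranspose (C ** matrix_inv C) ** d\<chi> \<mu> 0 ** matrix_inv B"
    by (simp only: ctranspose_mult matrix_mul_assoc)
  also have "\<dots> = weyl_titchmarsh V \<mu>" by (simp add: inv m B_def)
  finally show ?thesis .
qed

lemma matrix_analytic_on_end_value:
  assumes "\<And>\<mu>. matrix_solution V \<mu> (Y \<mu>) (dY \<mu>)" "\<And>\<mu>. Y \<mu> 0 = a" "\<And>\<mu>. dY \<mu> 0 = b"
  shows "matrix_analytic_on (\<lambda>\<mu>. Y \<mu> 1) A"
  unfolding matrix_analytic_on_def
proof (intro allI)
  fix i j
  obtain d\<chi> where \<chi>: "\<And>\<mu>. matrix_solution V \<mu> (\<lambda>x. chi V x \<mu>) (d\<chi> \<mu>)" "\<And>\<mu>. chi V 1 \<mu> = 0" "\<And>\<mu>. d\<chi> \<mu> 1 = mat 1"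
    using chi_family by blast
  have "(\<lambda>\<mu>. Y \<mu> 1 $ i $ j) field_differentiable at \<mu>" for \<mu>
    using end_value_has_derivative[OF V herm \<chi> assms] unfolding field_differentiable_def by blast
  then have "(\<lambda>\<mu>. Y \<mu> 1 $ i $ j) holomorphic_on UNIV"
    by (simp add: holomorphic_on_def)
  then have "(\<lambda>\<mu>. Y \<mu> 1 $ i $ j) analytic_on UNIV" by (simp add: analytic_on_open)
  then show "(\<lambda>\<mu>. Y \<mu> 1 $ i $ j) analytic_on A" by (rule analytic_on_subset) simp
qed

lemma phi_theta_analytic: "matrix_analytic_on (phi V 1) A" "matrix_analytic_on (theta V 1) A"
proof -
  obtain d\<phi> where \<phi>: "\<And>\<mu>. matrix_solution V \<mu> (\<lambda>x. phi V x \<mu>) (d\<phi> \<mu>)" "\<And>\<mu>. phi V 0 \<mu> = 0" "\<And>\<mu>. d\<phi> \<mu> 0 = mat 1"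
    using phi_family by blast
  obtain d\<theta> where \<theta>: "\<And>\<mu>. matrix_solution V \<mu> (\<lambda>x. theta V x \<mu>) (d\<theta> \<mu>)" "\<And>\<mu>. theta V 0 \<mu> = mat 1" "\<And>\<mu>. d\<theta> \<mu> 0 = 0"
    using theta_family by blast
  show "matrix_analytic_on (phi V 1) A" using matrix_analytic_on_end_value[OF \<phi>] by simp
  show "matrix_analytic_on (theta V 1) A" using matrix_analytic_on_end_value[OF \<theta>] by simp
qed

lemma weyl_titchmarsh_analytic: "matrix_analytic_on (weyl_titchmarsh V) (- eigenvalues V)"
  unfolding matrix_analytic_on_pointwise[of _ "- eigenvalues V"]
proof
  fix a assume a: "a \<in> - eigenvalues V"
  then have nz: "det (phi V 1 a) \<noteq> 0" by (simp add: not_eigenvalue_iff_det_phi[symmetric])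
  have an: "matrix_analytic_on (\<lambda>z. - (matrix_inv (phi V 1 z) ** theta V 1 z)) {a}"
    by (intro matrix_analytic_on_minus matrix_analytic_on_mult matrix_analytic_on_inv phi_theta_analytic nz)
  have ev: "\<forall>\<^sub>F z in nhds a. weyl_titchmarsh V z = - (matrix_inv (phi V 1 z) ** theta V 1 z)"
    using det_eventually_nonzero[OF phi_theta_analytic(1) nz]
    by eventually_elim (rule weyl_titchmarsh_formula, simp add: not_eigenvalue_iff_det_phi)
  show "matrix_analytic_on (weyl_titchmarsh V) {a}"
    unfolding matrix_analytic_on_def
  proof (intro allI)
    fix i j
    have "\<forall>\<^sub>F z in nhds a. weyl_titchmarsh V z $ i $ j = (- (matrix_inv (phi V 1 z) ** theta V 1 z)) $ i $ j"
      using ev by eventually_elim simp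
    then show "(\<lambda>z. weyl_titchmarsh V z $ i $ j) analytic_on {a}"
      using an unfolding matrix_analytic_on_def by (simp only: analytic_at_cong[OF _ refl])
  qed
qed

text \<open>Here \<open>D\<close> is the derivative of \<open>phi V 1\<close> at \<open>\<mu>\<close>, and \<open>T\<close> is \<open>\<phi>'(1,\<mu>)\<close>. Of the three identities
  for \<open>T u\<close>, the first and the last are Lagrange's identity at a real point, for \<open>phi\<close> with itself
  and for \<open>phi\<close> with \<open>theta\<close>. For the second, the eigenfunction \<open>phi u\<close> is also the solution with
  data \<open>0\<close> and \<open>T u\<close> at the right end, so it equals \<open>chi (T u)\<close>; this turns the kernel
  \<open>\<chi>\<^sup>* \<phi>\<close> of \<open>D\<close> into the kernel \<open>\<phi>\<^sup>* \<phi>\<close> of \<open>S\<close>.\<close>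
lemma eigenvalue_boundary_identities:
  assumes \<mu>: "\<mu> \<in> eigenvalues V"
  obtains D T where
    "\<forall>i j. ((\<lambda>z. phi V 1 z $ i $ j) has_field_derivative D $ i $ j) (at \<mu>)"
    "\<forall>u\<in>eigen_ker V \<mu>. \<forall>x. hinner (phi V 1 \<mu> *v x) (T *v u) = 0"
    "\<forall>u\<in>eigen_ker V \<mu>. \<forall>x. hinner (D *v x) (T *v u) = hinner (S_mat V \<mu> *v x) u"
    "\<forall>u\<in>eigen_ker V \<mu>. \<forall>x. hinner (theta V 1 \<mu> *v x) (T *v u) = hinner x u"
proof -
  have real: "cnj \<mu> = \<mu>" by (rule eigenvalue_real[OF \<mu>])
  obtain d\<phi> where \<phi>: "\<And>\<mu>. matrix_solution V \<mu> (\<lambda>x. phi V x \<mu>) (d\<phi> \<mu>)" "\<And>\<mu>. phi V 0 \<mu> = 0" "\<And>\<mu>. d\<phi> \<mu> 0 = mat 1"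
    using phi_family by blast
  obtain d\<theta> where \<theta>: "\<And>\<mu>. matrix_solution V \<mu> (\<lambda>x. theta V x \<mu>) (d\<theta> \<mu>)" "\<And>\<mu>. theta V 0 \<mu> = mat 1" "\<And>\<mu>. d\<theta> \<mu> 0 = 0"
    using theta_family by blast
  obtain d\<chi> where \<chi>: "\<And>\<mu>. matrix_solution V \<mu> (\<lambda>x. chi V x \<mu>) (d\<chi> \<mu>)" "\<And>\<mu>. chi V 1 \<mu> = 0" "\<And>\<mu>. d\<chi> \<mu> 1 = mat 1"
    using chi_family by blast
  have mat0: "mat 0 ** A = 0" for A :: "complex ^ 'n ^ 'n" by (simp add: vec_eq_iff)
  define T where "T = d\<phi> \<mu> 1"
  define D where "D = integral {0..1} (\<lambda>t. ctranspose (chi V t \<mu>) ** phi V t \<mu>)"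
  have L1: "ctranspose (phi V 1 \<mu>) ** T = ctranspose T ** phi V 1 \<mu>"
    using lagrange_identity[OF herm \<phi>(1)[of \<mu>] \<phi>(1)[of \<mu>]]
    by (simp add: \<phi>(2) T_def real matrix_mult_zero_left matrix_mult_zero_right mat0)
  have L2: "ctranspose T ** theta V 1 \<mu> = ctranspose (phi V 1 \<mu>) ** d\<theta> \<mu> 1 + mat 1"
    using lagrange_identity[OF herm \<phi>(1)[of \<mu>] \<theta>(1)[of \<mu>]]
    by (simp add: \<phi>(2,3) \<theta>(2,3) T_def real matrix_mult_zero_left matrix_mult_zero_right mat0 algebra_simps)
  show thesis
  proof (rule that[of D T]; intro allI ballI)
    have "matrix_solution V (cnj \<mu>) (\<lambda>x. chi V x \<mu>) (d\<chi> \<mu>)"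
      using \<chi>(1)[of \<mu>] real by simp
    from end_value_has_derivative[OF V herm this \<chi>(2,3) \<phi>]
    show "((\<lambda>z. phi V 1 z $ i $ j) has_field_derivative D $ i $ j) (at \<mu>)" for i j
      unfolding D_def .
    fix u x assume "u \<in> eigen_ker V \<mu>"
    then have u: "phi V 1 \<mu> *v u = 0" by (simp add: eigen_ker_def)
    show "hinner (phi V 1 \<mu> *v x) (T *v u) = 0"
      unfolding hinner_matrix matrix_vector_mul_assoc L1 by (simp add: matrix_vector_mul_assoc[symmetric] u)
    show "hinner (theta V 1 \<mu> *v x) (T *v u) = hinner x u"
    proof -
      have "hinner (theta V 1 \<mu> *v x) (T *v u) = hinner ((ctranspose T ** theta V 1 \<mu>) *v x) u"
        by (simp add: hinner_matrix' matrix_vector_mul_assoc[symmetric])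
      also have "\<dots> = hinner (ctranspose (phi V 1 \<mu>) *v (d\<theta> \<mu> 1 *v x)) u + hinner x u"
        unfolding L2 by (simp add: matrix_vector_mult_add_rdistrib matrix_vector_mul_assoc[symmetric])
      also have "\<dots> = hinner x u"
        unfolding hinner_matrix[of "ctranspose (phi V 1 \<mu>)"] by (simp add: u)
      finally show ?thesis .
    qed
    have chi_phi: "chi V t \<mu> *v (T *v u) = phi V t \<mu> *v u" if "t \<in> {0..1}" for t
      by (rule vector_solution_unique_right[OF V matrix_solution_mult_vector[OF \<chi>(1)]
            matrix_solution_mult_vector[OF \<phi>(1)] _ _ that]) (simp_all add: \<chi> u T_def)
    have int: "(\<lambda>t. ctranspose (Y t) ** phi V t \<mu>) integrable_on {0..1}" if "continuous_on {0..1} Y" for Y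
      by (intro integrable_continuous_real bounded_bilinear.continuous_on[OF bounded_bilinear_matrix_mult]
        bounded_linear.continuous_on[OF bounded_linear_ctranspose] that matrix_solution_continuous(1)[OF \<phi>(1)])
    have "hinner (D *v x) (T *v u) = integral {0..1} (\<lambda>t. hinner (phi V t \<mu> *v x) (chi V t \<mu> *v (T *v u)))"
      unfolding D_def hinner_integral[OF int[OF matrix_solution_continuous(1)[OF \<chi>(1)]]]
      by (simp add: matrix_vector_mul_assoc[symmetric] hinner_matrix[of "ctranspose (chi V t \<mu>)" for t])
    also have "\<dots> = integral {0..1} (\<lambda>t. hinner (phi V t \<mu> *v x) (phi V t \<mu> *v u))"
      by (rule Henstock_Kurzweil_Integration.integral_cong) (simp add: chi_phi)
    also have "\<dots> = hinner (S_mat V \<mu> *v x) u"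
      unfolding S_mat_def hinner_integral[OF int[OF matrix_solution_continuous(1)[OF \<phi>(1)]]]
      by (simp add: matrix_vector_mul_assoc[symmetric] hinner_matrix[of "ctranspose (phi V t \<mu>)" for t])
    finally show "hinner (D *v x) (T *v u) = hinner (S_mat V \<mu> *v x) u" .
  qed
qed

lemma g_op_hinner:
  assumes "v \<in> eigen_ker V \<mu>" "u \<in> eigen_ker V \<mu>"
  shows "hinner (g_op V \<mu> v) u = hinner (S_mat V \<mu> *v v) u"
  using assms
  by (simp add: g_op_def Let_def matrix_vector_mul_assoc[symmetric] hinner_matrix[of "orth_projector E" for E]
      eigen_projector)

lemma g_op_injective: "inj_on (g_op V \<mu>) (eigen_ker V \<mu>)"
proof (rule inj_onI)
  fix a b assume ab: "a \<in> eigen_ker V \<mu>" "b \<in> eigen_ker V \<mu>" "g_op V \<mu> a = g_op V \<mu> b"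
  have "a + (-1) *s b \<in> eigen_ker V \<mu>" by (intro eigen_ker_subspace ab)
  then have d: "a - b \<in> eigen_ker V \<mu>" by simp
  have "hinner (S_mat V \<mu> *v (a - b)) (a - b) = hinner (g_op V \<mu> a) (a - b) - hinner (g_op V \<mu> b) (a - b)"
    unfolding g_op_hinner[OF ab(1) d] g_op_hinner[OF ab(2) d] by (simp add: matrix_vector_mult_diff_distrib)
  then have "hinner (S_mat V \<mu> *v (a - b)) (a - b) = 0" using ab(3) by simp
  then have "a - b = 0" by (rule S_positive)
  then show "a = b" by simp
qed

text \<open>The matrix \<open>K = F(\<mu>) + F'(\<mu>) P\<close> with \<open>F = phi V 1\<close> satisfies \<open>\<langle>K w, T u\<rangle> = \<langle>S P w, u\<rangle>\<close> for all
  \<open>u\<close> in the kernel. If \<open>K w = 0\<close>, positivity of \<open>S\<close> gives \<open>P w = 0\<close>, hence \<open>F(\<mu>) w = 0\<close> and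
  \<open>w = P w = 0\<close>; so \<open>K\<close> is invertible and the inverse of \<open>F\<close> has at most a simple pole. Solving \<open>K w = \<theta>(1,\<mu>) x\<close> then shows that \<open>P w = - R x\<close> is the solution of \<open>g (P w) = P x\<close>.\<close>
lemma weyl_titchmarsh_principal_part:
  assumes \<mu>: "\<mu> \<in> eigenvalues V"
  obtains R G where "matrix_analytic_on G {\<mu>}"
    "\<forall>\<^sub>F z in at \<mu>. weyl_titchmarsh V z = mat (inverse (z - \<mu>)) ** R + G z"
    "\<forall>x. - (R *v x) \<in> eigen_ker V \<mu>"
    "\<forall>x. g_op V \<mu> (- (R *v x)) = orth_projector (eigen_ker V \<mu>) *v x"
proof -
  define P where "P = orth_projector (eigen_ker V \<mu>)"
  note P = eigen_projector[where V = V and \<mu> = \<mu>, folded P_def]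
  obtain D T where
    D': "\<forall>i j. ((\<lambda>z. phi V 1 z $ i $ j) has_field_derivative D $ i $ j) (at \<mu>)" and
    T': "\<forall>u\<in>eigen_ker V \<mu>. \<forall>x. hinner (phi V 1 \<mu> *v x) (T *v u) = 0"
    "\<forall>u\<in>eigen_ker V \<mu>. \<forall>x. hinner (D *v x) (T *v u) = hinner (S_mat V \<mu> *v x) u"
    "\<forall>u\<in>eigen_ker V \<mu>. \<forall>x. hinner (theta V 1 \<mu> *v x) (T *v u) = hinner x u"
    by (rule eigenvalue_boundary_identities[OF \<mu>])
  note D = D'[rule_format] and T = T'[rule_format]
  define K where "K = phi V 1 \<mu> + D ** P"
  have K: "hinner (K *v w) (T *v u) = hinner (S_mat V \<mu> *v (P *v w)) u" if "u \<in> eigen_ker V \<mu>" for u w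
    by (simp add: K_def matrix_vector_mult_add_rdistrib matrix_vector_mul_assoc[symmetric] T[OF that])
  have nz: "det K \<noteq> 0"
    unfolding det_nonzero_iff_kernel
  proof (intro allI impI)
    fix v assume v: "K *v v = 0"
    have "hinner (S_mat V \<mu> *v (P *v v)) (P *v v) = 0"
      using K[OF P(2)[of v], of v] v by simp
    then have Pv: "P *v v = 0" by (rule S_positive)
    then have "phi V 1 \<mu> *v v = 0"
      using v by (simp add: K_def matrix_vector_mult_add_rdistrib matrix_vector_mul_assoc[symmetric])
    then have "v \<in> eigen_ker V \<mu>" by (simp add: eigen_ker_def)
    then show "v = 0" using P(3) Pv by metis
  qed
  have FP: "phi V 1 \<mu> ** P = 0"
    unfolding matrix_eq using P(2) by (simp add: matrix_vector_mul_assoc[symmetric] eigen_ker_def)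
  obtain G where G: "matrix_analytic_on G {\<mu>}"
    "\<forall>\<^sub>F z in at \<mu>. det (phi V 1 z) \<noteq> 0 \<and>
      matrix_inv (phi V 1 z) ** theta V 1 z = mat (inverse (z - \<mu>)) ** (P ** matrix_inv K ** theta V 1 \<mu>) + G z"
    using simple_pole_of_inverse[OF phi_theta_analytic D P(5) FP] nz unfolding K_def by blast
  define R where "R = - (P ** matrix_inv K ** theta V 1 \<mu>)"
  have Rx: "- (R *v x) = P *v (matrix_inv K *v (theta V 1 \<mu> *v x))" for x
    by (simp add: R_def matrix_vector_mul_assoc matrix_mul_assoc bounded_bilinear.minus_left[OF bounded_bilinear_matrix_vector_mult])
  show thesis
  proof (rule that[of "\<lambda>z. - G z" R]; (intro allI)?)
    show "matrix_analytic_on (\<lambda>z. - G z) {\<mu>}" by (rule matrix_analytic_on_minus[OF G(1)])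
    show "\<forall>\<^sub>F z in at \<mu>. weyl_titchmarsh V z = mat (inverse (z - \<mu>)) ** R + - G z"
      using G(2)
      by eventually_elim
        (simp add: weyl_titchmarsh_formula not_eigenvalue_iff_det_phi R_def matrix_mult_minus_right)
    fix x
    define w where "w = matrix_inv K *v (theta V 1 \<mu> *v x)"
    have Pw: "- (R *v x) = P *v w" using Rx w_def by simp
    have Kw: "K *v w = theta V 1 \<mu> *v x"
      by (simp add: w_def matrix_vector_mul_assoc matrix_mul_assoc matrix_inv_both[OF nz])
    show in_E: "- (R *v x) \<in> eigen_ker V \<mu>" unfolding Pw by (rule P(2))
    \<comment> \<open>The defect lies in the kernel and is orthogonal to the kernel.\<close>
    define d where "d = g_op V \<mu> (P *v w) - P *v x"
    have d: "d = P *v (S_mat V \<mu> *v (P *v (P *v w)) - x)"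
      by (simp add: d_def g_op_def Let_def P_def[symmetric] matrix_vector_mul_assoc[symmetric] matrix_vector_mult_diff_distrib)
    then have dE: "d \<in> eigen_ker V \<mu>" using P(2) by simp
    have "hinner d d = hinner (g_op V \<mu> (P *v w)) d - hinner (P *v x) d"
      by (simp add: d_def)
    also have "\<dots> = hinner (S_mat V \<mu> *v (P *v w)) d - hinner x d"
      by (simp add: g_op_hinner[OF P(2) dE] hinner_matrix[of P x] P(1) P(3)[OF dE])
    also have "\<dots> = 0" using K[OF dE, of w] T(3)[OF dE, of x] by (simp add: Kw)
    finally have "d = 0" by simp
    then show "g_op V \<mu> (- (R *v x)) = orth_projector (eigen_ker V \<mu>) *v x"
      unfolding Pw by (simp add: d_def P_def)
  qed
qed

end

theorem proposition1p6:
  fixes V :: "real \<Rightarrow> complex ^ 'n ^ 'n"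
  assumes V_integrable: "V absolutely_integrable_on {0<..<1}"
    and V_hermitian: "AE x in lebesgue_on {0<..<1}. ctranspose (V x) = V x"
  shows "matrix_analytic_on (weyl_titchmarsh V) (- eigenvalues V) \<and>
    (\<forall>\<mu>. \<mu> \<notin> eigenvalues V \<longrightarrow>
       weyl_titchmarsh V \<mu> = ctranspose (weyl_titchmarsh V (cnj \<mu>))) \<and>
    (\<forall>\<mu>\<in>eigenvalues V.
       matrix_simple_pole (weyl_titchmarsh V) \<mu> \<and>
       bij_betw (g_op V \<mu>) (eigen_ker V \<mu>) (eigen_ker V \<mu>) \<and>
       (\<forall>v\<in>eigen_ker V \<mu>.
          matrix_residue (weyl_titchmarsh V) \<mu> *v v = - inv_into (eigen_ker V \<mu>) (g_op V \<mu>) v) \<and>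
       (\<forall>w\<in>orth_compl (eigen_ker V \<mu>). matrix_residue (weyl_titchmarsh V) \<mu> *v w = 0))"
proof (intro conjI allI impI ballI)
  note V = absolutely_integrable_open_closed[OF V_integrable] and herm = V_hermitian
  show "matrix_analytic_on (weyl_titchmarsh V) (- eigenvalues V)"
    by (rule weyl_titchmarsh_analytic[OF V herm])
  show "weyl_titchmarsh V \<mu> = ctranspose (weyl_titchmarsh V (cnj \<mu>))" if "\<mu> \<notin> eigenvalues V" for \<mu>
    by (rule weyl_titchmarsh_symmetric[OF V herm that])
  fix \<mu> assume \<mu>: "\<mu> \<in> eigenvalues V"
  let ?E = "eigen_ker V \<mu>" and ?g = "g_op V \<mu>"
  obtain R G where G: "matrix_analytic_on G {\<mu>}"
    "\<forall>\<^sub>F z in at \<mu>. weyl_titchmarsh V z = mat (inverse (z - \<mu>)) ** R + G z"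
    and R': "\<forall>x. - (R *v x) \<in> ?E" "\<forall>x. ?g (- (R *v x)) = orth_projector ?E *v x"
    by (rule weyl_titchmarsh_principal_part[OF V herm \<mu>])
  note R = R'[rule_format]
  note P = eigen_projector[where V = V and \<mu> = \<mu>]
  have res: "matrix_residue (weyl_titchmarsh V) \<mu> = R"
    by (rule matrix_residue_simple_pole[OF G])
  have g0: "?g 0 = 0" by (simp add: g_op_def Let_def)
  have inj: "inj_on ?g ?E" by (rule g_op_injective[OF V herm])
  show "matrix_simple_pole (weyl_titchmarsh V) \<mu>"
    unfolding matrix_simple_pole_def
  proof (intro exI conjI)
    show "R \<noteq> 0"
    proof
      assume "R = 0"
      then have "orth_projector ?E *v x = 0" for x using R(2)[of x] g0 by simp
      then have "phi V 1 \<mu> *v v = 0 \<longrightarrow> v = 0" for v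
        using P(3)[of v] by (simp add: eigen_ker_def)
      then show False
        using \<mu> not_eigenvalue_iff_det_phi[OF V herm] det_nonzero_iff_kernel by blast
    qed
    show "matrix_analytic_on G {\<mu>}" by (fact G(1))
    show "\<forall>\<^sub>F z in at \<mu>. weyl_titchmarsh V z = mat (inverse (z - \<mu>)) ** R + G z" by (fact G(2))
  qed
  show "bij_betw ?g ?E ?E"
    unfolding bij_betw_def
  proof (intro conjI inj subset_antisym subsetI)
    fix x assume "x \<in> ?g ` ?E"
    then show "x \<in> ?E" using P(2) by (auto simp: g_op_def Let_def matrix_vector_mul_assoc[symmetric])
  next
    fix x assume "x \<in> ?E"
    then have "x = ?g (- (R *v x))" using R(2)[of x] P(3) by simp
    then show "x \<in> ?g ` ?E" using R(1)[of x] by blast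
  qed
  show "matrix_residue (weyl_titchmarsh V) \<mu> *v v = - inv_into ?E ?g v" if "v \<in> ?E" for v
  proof -
    have "inv_into ?E ?g v = - (R *v v)"
      by (rule inv_into_f_eq[OF inj R(1)]) (simp add: R(2) P(3)[OF that])
    then show ?thesis by (simp add: res)
  qed
  show "matrix_residue (weyl_titchmarsh V) \<mu> *v w = 0" if "w \<in> orth_compl ?E" for w
  proof -
    have "?g (- (R *v w)) = ?g 0" using R(2)[of w] P(4)[OF that] g0 by simp
    then have "- (R *v w) = 0" by (rule inj_onD[OF inj]) (use R(1) eigen_ker_subspace in auto)
    then show ?thesis by (simp add: res)
  qed
qed

end
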